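(* Let $\rho>1$, let $f$ be analytic inside and on the Bernstein ellipse $\mathcal{E}_\rho$, let $M=\max_{z\in\mathcal{E}_\rho}|f(z)|$ and let $L(\mathcal{E}_\rho)$ be the length of $\mathcal{E}_\rho$. For an integer $N\ge0$ let $f_N(x)=\sum_{n=0}^{N-1}a_n^\lambda C_n^{(\lambda)}(x)$. Then for all $x\in[-1,1]$: if $0<\lambda\le1$, \[ |f(x)-f_N(x)|\le\frac{ML(\mathcal{E}_\rho)\Gamma(\lambda)}{\pi\Gamma(2\lambda)}\sum_{n=N}^\infty\frac{\Gamma(n+2\lambda)}{\Gamma(n+\lambda)\rho^{n+1}}\;{}_2F_1\!\left[\begin{matrix} n+1,\ 1-\lambda\\ n+\lambda+1\end{matrix};\ \frac{1}{\rho^2}\right]; \] in particular, if $\lambda=1$, \[ |f(x)-f_N(x)|\le\frac{ML(\mathcal{E}_\rho)}{\pi\rho^N}\cdot\frac{N(\rho-1)+\rho}{(\rho-1)^2}; \] and if $\lambda>1$, \[ |f(x)-f_N(x)|\le\frac{ML(\mathcal{E}_\rho)\Gamma(\lambda)}{\pi\Gamma(2\lambda)}\sum_{n=N}^\infty\frac{\Gamma(n+2\lambda)}{\Gamma(n+\lambda)\rho^{n+1}}\;{}_2F_1\!\left[\begin{matrix} n+1,\ 1-\lambda\\ n+\lambda+1\end{matrix};\ -\frac{1}{\rho^2}\right]. \]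
   Context: $C_n^{(\lambda)}$ is the Gegenbauer polynomial normalized by $C_n^{(\lambda)}(1)=\Gamma(n+2\lambda)/(n!\,\Gamma(2\lambda))$, orthogonal on $[-1,1]$ with weight $(1-x^2)^{\lambda-1/2}$, with $h_n^{(\lambda)}=\frac{2^{1-2\lambda}\pi}{\Gamma(\lambda)^2}\frac{\Gamma(n+2\lambda)}{\Gamma(n+1)(n+\lambda)}$ its squared weighted norm; the Gegenbauer coefficients of $f$ are $a_n^{\lambda}=\frac{1}{h_n^{(\lambda)}}\int_{-1}^1(1-x^2)^{\lambda-1/2}f(x)C_n^{(\lambda)}(x)\,dx$. $\mathcal{E}_\rho=\{\tfrac12(\rho e^{i\theta}+\rho^{-1}e^{-i\theta}):0\le\theta\le2\pi\}$. ${}_2F_1$ is the Gauss hypergeometric function. *)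

theory Defs
  imports "HOL-Analysis.Analysis"
begin

text \<open>Gegenbauer polynomial, explicit formula; Gamma(n-k+lambda)/Gamma(lambda) = pochhammer.
  Normalised so that C_n(1) = Gamma(n+2 lambda)/(n! Gamma(2 lambda)).\<close>
definition gegenbauer :: "real \<Rightarrow> nat \<Rightarrow> real \<Rightarrow> real" where
  "gegenbauer lam n x =
     (\<Sum>k\<le>n div 2. (-1) ^ k * pochhammer lam (n - k) / (fact k * fact (n - 2 * k))
                      * (2 * x) ^ (n - 2 * k))"

text \<open>Squared weighted norm h_n.\<close>
definition gegenbauer_h :: "real \<Rightarrow> nat \<Rightarrow> real" where
  "gegenbauer_h lam n =
     2 powr (1 - 2 * lam) * pi / (Gamma lam) ^ 2
       * Gamma (real n + 2 * lam) / (Gamma (real n + 1) * (real n + lam))"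

definition gegenbauer_coeff :: "real \<Rightarrow> (complex \<Rightarrow> complex) \<Rightarrow> nat \<Rightarrow> complex" where
  "gegenbauer_coeff lam f n =
     complex_of_real (1 / gegenbauer_h lam n) *
     (LBINT x = -1..1. complex_of_real ((1 - x\<^sup>2) powr (lam - 1/2) * gegenbauer lam n x)
                          * f (complex_of_real x))"

definition gegenbauer_partial :: "real \<Rightarrow> (complex \<Rightarrow> complex) \<Rightarrow> nat \<Rightarrow> real \<Rightarrow> complex" where
  "gegenbauer_partial lam f N x =
     (\<Sum>n<N. gegenbauer_coeff lam f n * complex_of_real (gegenbauer lam n x))"

definition bernstein_path :: "real \<Rightarrow> real \<Rightarrow> complex" where
  "bernstein_path \<rho> \<theta> =
     (complex_of_real \<rho> * exp (\<i> * complex_of_real \<theta>)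
      + complex_of_real (inverse \<rho>) * exp (- \<i> * complex_of_real \<theta>)) / 2"

definition bernstein_ellipse :: "real \<Rightarrow> complex set" where
  "bernstein_ellipse \<rho> = bernstein_path \<rho> ` {0..2*pi}"

text \<open>Closed region bounded by the ellipse (inside and on): foci at +-1,
  sum of focal distances rho + 1/rho.\<close>
definition bernstein_region :: "real \<Rightarrow> complex set" where
  "bernstein_region \<rho> = {z. cmod (z - 1) + cmod (z + 1) \<le> \<rho> + inverse \<rho>}"

definition bernstein_length :: "real \<Rightarrow> real" where
  "bernstein_length \<rho> =
     integral {0..2*pi} (\<lambda>\<theta>. norm (vector_derivative (bernstein_path \<rho>) (at \<theta>)))"

definition hyp2F1 :: "real \<Rightarrow> real \<Rightarrow> real \<Rightarrow> real \<Rightarrow> real" where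
  "hyp2F1 a b c z =
     (\<Sum>k. pochhammer a k * pochhammer b k / (pochhammer c k * fact k) * z ^ k)"

end

theory Submission
  imports Defs "HOL-Complex_Analysis.Complex_Analysis"
begin

text \<open>Parametrise the outside of the interval by z = (v + 1/v)/2 with 0 < |v| < 1. The functions of
  the second kind Q_n(v), a power of v times a hypergeometric series in v^2, satisfy the three-term
  recurrence dual to that of C_n, so (z - x) (C_0 Q_0 + ... + C_N Q_N) telescopes and
  1/(z - x) = C_0(x) Q_0(v) + C_1(x) Q_1(v) + .... Inserting this into Cauchy's formula on the ellipse
  expands f in Gegenbauer polynomials; by orthogonality the coefficients, which are contour integrals
  of f against Q_n, are the Gegenbauer coefficients. The remainder is then bounded termwise, with
  |C_n(x)| at most C_n(1) and |Q_n| on |v| = 1/rho at most its value at v = 1/rho (lambda at most 1,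
  nonnegative series) or in modulus at v = i/rho (lambda above 1, Euler's integral).\<close>

section \<open>Gegenbauer polynomials on the interval\<close>

text \<open>Two estimates of Q_n serve different purposes. Convergence and every exchange of limit
  and integral rest on a crude one, uniform on |v| \<le> r < 1, in which n enters only through (n +
  \<lambda>) r^(n + 1). The final inequality needs the exact maximum on |v| = 1/\<rho>. Where that
  maximum lies depends on the signs of (1 - \<lambda>)_k. For \<lambda> \<le> 1 none is negative and
  the triangle inequality is sharp at v^2 > 0. For \<lambda> > 1 the signs vary and the triangle
  inequality for the series is too weak in general; Euler's integral replaces the series by |1 - t
  v^2|^(\<lambda> - 1) with positive exponent, largest at v^2 < 0. The constant arises as follows:
  Cauchy's formula and the length of the contour give M L / (2 pi), the bound on C_n gives (2
  \<lambda>)_n / n!, and the bound on Q_n gives 2 n! / (\<lambda>)_n \<rho>^(-n-1) times the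
  hypergeometric value. The 2 and the n! cancel, and the quotient of Pochhammer symbols becomes the
  quotient of Gamma values.\<close>

lemma gegenbauer_0 [simp]: "gegenbauer l 0 x = 1"
  by (simp add: gegenbauer_def)

lemma gegenbauer_1 [simp]: "gegenbauer l (Suc 0) x = 2 * l * x"
  by (simp add: gegenbauer_def)

text \<open>The recurrence holds power by power: multiplication by x keeps the index k and raises
  the degree, while the term k of C_n has the same power of x as the term k + 1 of C_(n+2).\<close>

lemma gegenbauer_rec:
  "real (n + 2) * gegenbauer l (n + 2) x =
     2 * (real n + 1 + l) * x * gegenbauer l (n + 1) x - (real n + 2 * l) * gegenbauer l n x"
proof -
  \<comment> \<open>Padding the summand with 0 lets the three sums share one range, so that the
    recurrence can be checked for each k separately.\<close>
  define g where "g n k = (if 2 * k \<le> n then (-1) ^ k * pochhammer l (n - k) / (fact k * fact (n - 2 * k))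
                      * (2 * x) ^ (n - 2 * k) else 0)" for n k :: nat
  have geg: "gegenbauer l m x = (\<Sum>k\<le>n. g m k)" if "m div 2 \<le> n" for m n
  proof -
    have "gegenbauer l m x = (\<Sum>k\<le>m div 2. g m k)"
      unfolding gegenbauer_def by (intro sum.cong) (auto simp: g_def)
    also have "\<dots> = (\<Sum>k\<le>n. g m k)"
      using that by (intro sum.mono_neutral_left) (auto simp: g_def)
    finally show ?thesis .
  qed
  have step0: "real (n + 2) * g (n + 2) 0 = 2 * (real n + 1 + l) * x * g (n + 1) 0"
  proof -
    define P where "P = pochhammer l n"
    define F where "F = (fact n :: real)"
    define X where "X = (2 * x) ^ n"
    define r where "r = real n"
    have nz: "F \<noteq> 0" "r + 1 \<noteq> 0" "r + 2 \<noteq> 0" unfolding F_def r_def by (auto simp: add_nonneg_eq_0_iff)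
    have g2: "g (n + 2) 0 = (P * (l + r) * (l + r + 1)) / ((r + 2) * ((r + 1) * F)) * (2 * x * (2 * x * X))"
      unfolding g_def by (simp add: P_def F_def X_def r_def pochhammer_Suc algebra_simps)
    have g1: "g (n + 1) 0 = (P * (l + r)) / ((r + 1) * F) * (2 * x * X)"
      unfolding g_def by (simp add: P_def F_def X_def r_def pochhammer_Suc algebra_simps)
    show ?thesis unfolding g2 g1 of_nat_add using nz
      by (simp add: divide_simps flip: r_def)
  qed
  have step: "real (n + 2) * g (n + 2) (Suc k) =
      2 * (real n + 1 + l) * x * g (n + 1) (Suc k) - (real n + 2 * l) * g n k" for k
  proof -
    \<comment> \<open>For 2 k > n all three terms vanish; for 2 k = n they are constant terms and
      the middle one, of odd degree n + 1, is absent; otherwise all three are genuine.\<close>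
    consider "2 * k > n" | "2 * k = n" | j where "n = 2 * k + Suc j"
      by (metis add_Suc_right less_imp_Suc_add linorder_neqE_nat)
    then show ?thesis
    proof cases
      case 3
      have 1: "n - k = Suc (k + j)" "n + 2 - Suc k = Suc (Suc (k+j))" "n + 1 - Suc k = Suc (k+j)"
        "n + 2 - 2 * Suc k = Suc j" "n + 1 - 2 * Suc k = j" "n - 2 * k = Suc j"
        using 3 by auto
      have 2: "2 * Suc k \<le> n + 2" "2 * Suc k \<le> n + 1" "2 * k \<le> n" using 3 by auto
      have n: "real n = 2 * real k + 1 + real j" using 3 by simp
      define P where "P = pochhammer l (k+j)"
      define F where "F = (fact k :: real)"
      define J where "J = (fact j :: real)"
      define X where "X = (2 * x) ^ j"
      have nz: "F \<noteq> 0" "J \<noteq> 0" "real k + 1 \<noteq> 0" "real j + 1 \<noteq> 0" unfolding F_def J_def by auto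
      have g2: "g (n + 2) (Suc k) = - ((-1)^k) * (P * (l + real k + real j) * (l + real k + real j + 1)) / (((real k + 1) * F) * ((real j + 1) * J)) * (2 * x * X)"
        using 2 unfolding g_def 1 by (simp add: P_def F_def J_def X_def pochhammer_Suc algebra_simps)
      have g1: "g (n + 1) (Suc k) = - ((-1)^k) * (P * (l + real k + real j)) / (((real k + 1) * F) * J) * X"
        using 2 unfolding g_def 1 by (simp add: P_def F_def J_def X_def pochhammer_Suc algebra_simps)
      have g0: "g n k = ((-1)^k) * (P * (l + real k + real j)) / (F * ((real j + 1) * J)) * (2 * x * X)"
        using 2 unfolding g_def 1 by (simp add: P_def F_def J_def X_def pochhammer_Suc algebra_simps)
      show ?thesis unfolding g2 g1 g0 of_nat_add n using nz
        by (simp add: divide_simps) algebra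
    next
      case 2
      then have n: "n = 2 * k" by simp
      have 1: "2 * k - k = k" "2 * k + 2 - Suc k = Suc k" by auto
      show ?thesis unfolding n g_def by (simp add: 1 pochhammer_Suc divide_simps) algebra
    qed (simp add: g_def)
  qed
  have "gegenbauer l (n+2) x = (\<Sum>k\<le>Suc n. g (n+2) k)" "gegenbauer l (n+1) x = (\<Sum>k\<le>Suc n. g (n+1) k)"
    "gegenbauer l n x = (\<Sum>k\<le>n. g n k)"
    by (rule geg; simp)+
  then have e: "gegenbauer l (n+2) x = g (n+2) 0 + (\<Sum>k\<le>n. g (n+2) (Suc k))"
    "gegenbauer l (n+1) x = g (n+1) 0 + (\<Sum>k\<le>n. g (n+1) (Suc k))"
    "gegenbauer l n x = (\<Sum>k\<le>n. g n k)"
    by (simp_all only: sum.atMost_Suc_shift)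
  show ?thesis
    unfolding e distrib_left step0 sum_distrib_left step sum_subtractf by (simp only: add_diff_eq)
qed

text \<open>The factorisation 1 - 2xt + t^2 = (1 - at)(1 - bt) of the generating function; for a = exp(i phi), b = exp(-i phi)
  it writes C_n(cos phi) as a combination of exponentials with nonnegative coefficients.\<close>

lemma gegenbauer_trig:
  fixes a b :: complex and l x :: real
  assumes "a * b = 1" "a + b = 2 * complex_of_real x"
  defines "\<alpha> \<equiv> (\<lambda>k. complex_of_real (pochhammer l k / fact k))"
  shows "complex_of_real (gegenbauer l n x) = (\<Sum>k\<le>n. \<alpha> k * a ^ k * (\<alpha> (n - k) * b ^ (n - k)))"
proof -
  define A where "A c = Abs_fps (\<lambda>k. \<alpha> k * c ^ k)" for c
  define G where "G = A a * A b"
  \<comment> \<open>\<open>A c\<close> is the binomial series (1 - c X)^(-l), characterised here by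
    its first-order differential equation.\<close>
  have dA: "fps_deriv (A c) * (1 - fps_const c * fps_X) = fps_const (of_real l * c) * A c" for c
  proof (rule fps_ext)
    fix n
    have \<alpha>S: "of_nat (Suc m) * \<alpha> (Suc m) = (of_real l + of_nat m) * \<alpha> m" for m
    proof -
      have "real (Suc m) * (pochhammer l (Suc m) / fact (Suc m)) = (l + real m) * (pochhammer l m / fact m)"
        by (simp add: pochhammer_Suc divide_simps)
      then have "complex_of_real (real (Suc m) * (pochhammer l (Suc m) / fact (Suc m))) = of_real ((l + real m) * (pochhammer l m / fact m))"
        by (rule arg_cong)
      then show ?thesis unfolding \<alpha>_def by (simp only: of_real_mult of_real_add of_real_of_nat_eq)
    qed
    have "fps_nth (fps_deriv (A c) * (1 - fps_const c * fps_X)) n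
      = fps_nth (fps_deriv (A c) - fps_const c * (fps_deriv (A c) * fps_X)) n"
      by (simp add: algebra_simps)
    also have "\<dots> = of_nat (Suc n) * \<alpha> (Suc n) * c ^ Suc n - (if n = 0 then 0 else c * (of_nat n * \<alpha> n * c ^ n))"
      by (cases n) (simp_all add: A_def algebra_simps)
    also have "\<dots> = of_real l * c * \<alpha> n * c ^ n"
      unfolding \<alpha>S by (cases n) (simp_all add: algebra_simps)
    finally show "fps_nth (fps_deriv (A c) * (1 - fps_const c * fps_X)) n = fps_nth (fps_const (of_real l * c) * A c) n"
      by (simp add: A_def algebra_simps)
  qed
  have fac: "(1 - fps_const a * fps_X) * (1 - fps_const b * fps_X) = 1 - fps_const (2 * of_real x) * fps_X + fps_X ^ 2"
  proof -
    have "(1 - fps_const a * fps_X) * (1 - fps_const b * fps_X)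
        = 1 - (fps_const a + fps_const b) * fps_X + (fps_const a * fps_const b) * fps_X ^ 2"
      by (simp add: algebra_simps power2_eq_square del: fps_const_add fps_const_mult)
    then show ?thesis using assms(1,2) by simp
  qed
  have ode: "fps_deriv G * (1 - fps_const (2 * of_real x) * fps_X + fps_X ^ 2)
      = fps_const (of_real l) * (fps_const (2 * of_real x) - 2 * fps_X) * G"
  proof -
    have "fps_deriv G * (1 - fps_const (2 * of_real x) * fps_X + fps_X ^ 2)
      = (fps_deriv (A a) * (1 - fps_const a * fps_X)) * (1 - fps_const b * fps_X) * A b
      + (fps_deriv (A b) * (1 - fps_const b * fps_X)) * (1 - fps_const a * fps_X) * A a"
      unfolding fac[symmetric] G_def by (simp add: algebra_simps del: fps_const_mult)
    also have "\<dots> = fps_const (of_real l) * (fps_const a + fps_const b - 2 * (fps_const a * fps_const b) * fps_X) * G"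
      unfolding dA G_def by (simp add: algebra_simps fps_const_mult[symmetric] del: fps_const_add fps_const_mult)
    finally show ?thesis using assms(1,2) by simp
  qed
  \<comment> \<open>Comparing coefficients of X^(m + 1) in the differential equation of the product
    yields exactly the recurrence \<open>gegenbauer_rec\<close>; with equal initial values the two
    sequences coincide.\<close>
  have rec: "of_nat (m + 2) * fps_nth G (m + 2) =
     2 * (of_nat m + 1 + of_real l) * of_real x * fps_nth G (m + 1) - (of_nat m + 2 * of_real l) * fps_nth G m" for m
  proof -
    have "fps_nth (fps_deriv G * (1 - fps_const (2 * of_real x) * fps_X + fps_X ^ 2)) (m + 1)
       = fps_nth (fps_deriv G - fps_const (2 * of_real x) * (fps_deriv G * fps_X) + fps_deriv G * fps_X * fps_X) (m + 1)"
      by (simp add: algebra_simps power2_eq_square)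
    also have "\<dots> = of_nat (m+2) * fps_nth G (m+2) - 2 * of_real x * (of_nat (m+1) * fps_nth G (m+1)) + of_nat m * fps_nth G m"
      by (cases m) (simp_all add: numeral_2_eq_2)
    also note ode
    also have "fps_nth (fps_const (of_real l) * (fps_const (2 * of_real x) - 2 * fps_X) * G) (m + 1)
      = fps_nth (fps_const (of_real l) * (fps_const (2 * of_real x) * G - fps_const 2 * (G * fps_X))) (m + 1)"
      by (simp add: algebra_simps flip: numeral_fps_const)
    also have "\<dots> = of_real l * (2 * of_real x * fps_nth G (m + 1) - 2 * fps_nth G m)"
      by simp
    finally show ?thesis by (simp add: algebra_simps)
  qed
  have G01: "fps_nth G 0 = 1" "fps_nth G 1 = 2 * of_real l * of_real x"
  proof -
    have "fps_nth G 1 = of_real l * (a + b)"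
      by (simp add: G_def A_def fps_mult_nth \<alpha>_def algebra_simps)
    then show "fps_nth G 1 = 2 * of_real l * of_real x" using assms(2) by simp
  qed (simp add: G_def A_def \<alpha>_def)
  have "complex_of_real (gegenbauer l n x) = fps_nth G n"
  proof (induction n rule: less_induct)
    case (less n)
    consider "n = 0" | "n = 1" | m where "n = m + 2"
      by (metis add.commute add_2_eq_Suc' One_nat_def not0_implies_Suc)
    then show ?case
    proof cases
      case 3
      have "complex_of_real (real (m + 2) * gegenbauer l (m + 2) x) = of_nat (m + 2) * fps_nth G (m + 2)"
        unfolding rec gegenbauer_rec using less[of m] less[of "m + 1"] 3 by simp
      then show ?thesis using 3
        by (metis add_2_eq_Suc' mult_left_cancel of_nat_neq_0 of_real_mult of_real_of_nat_eq)
    qed (use G01 in auto)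
  qed
  then show ?thesis by (simp add: G_def A_def fps_mult_nth atLeast0AtMost)
qed

text \<open>With |a| = |b| = 1 and nonnegative coefficients the triangle inequality bounds |C_n| by
  its value at x = 1; the Vandermonde convolution of Pochhammer symbols evaluates that sum.\<close>

lemma abs_gegenbauer_le:
  assumes "l > 0" "x \<in> {-1..1}"
  shows "\<bar>gegenbauer l n x\<bar> \<le> pochhammer (2 * l) n / fact n"
proof -
  define \<alpha> where "\<alpha> k = pochhammer l k / fact k" for k
  define t where "t = arccos x"
  have "complex_of_real (gegenbauer l n x)
    = (\<Sum>k\<le>n. complex_of_real (\<alpha> k) * cis t ^ k * (complex_of_real (\<alpha> (n - k)) * cis (-t) ^ (n - k)))"
    unfolding \<alpha>_def
    by (rule gegenbauer_trig) (use assms in \<open>auto simp: t_def cis_mult complex_eq_iff cos_arccos\<close>)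
  then have "\<bar>gegenbauer l n x\<bar> = cmod (\<Sum>k\<le>n. complex_of_real (\<alpha> k) * cis t ^ k * (complex_of_real (\<alpha> (n - k)) * cis (-t) ^ (n - k)))"
    by (metis norm_of_real)
  also have "\<dots> \<le> (\<Sum>k\<le>n. \<alpha> k * \<alpha> (n - k))"
    using assms(1) by (intro order.trans[OF norm_sum] sum_mono)
      (auto simp: norm_mult norm_power norm_divide \<alpha>_def abs_mult pochhammer_nonneg)
  also have "\<dots> = (\<Sum>k\<le>n. of_nat (n choose k) * pochhammer l k * pochhammer l (n - k)) / fact n"
    by (simp add: sum_divide_distrib \<alpha>_def binomial_fact)
  also have "\<dots> = pochhammer (2 * l) n / fact n"
    unfolding mult_2 pochhammer_binomial_sum ..
  finally show ?thesis .
qed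

section \<open>Derivatives and first-order differential relations\<close>

lemma gegenbauer_poly: "\<exists>p. \<forall>x. gegenbauer l n x = poly p x"
  unfolding gegenbauer_def
  by (rule exI[of _ "\<Sum>k\<le>n div 2. monom ((-1) ^ k * pochhammer l (n - k) / (fact k * fact (n - 2 * k)) * 2 ^ (n - 2 * k)) (n - 2 * k)"])
     (simp add: poly_sum poly_monom power_mult_distrib algebra_simps)

definition gegenbauer' :: "real \<Rightarrow> nat \<Rightarrow> real \<Rightarrow> real" where
  "gegenbauer' l n = deriv (gegenbauer l n)"

lemma gegenbauer_DERIV: "(gegenbauer l n has_real_derivative gegenbauer' l n x) (at x within A)"
proof -
  obtain p where "\<forall>x. gegenbauer l n x = poly p x" using gegenbauer_poly by blast
  then have "gegenbauer l n = poly p" by auto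
  then show ?thesis unfolding gegenbauer'_def
    by (metis DERIV_imp_deriv has_field_derivative_at_within poly_DERIV)
qed

lemma continuous_on_gegenbauer [continuous_intros]:
  fixes g :: "'a::topological_space \<Rightarrow> real"
  shows "continuous_on A g \<Longrightarrow> continuous_on A (\<lambda>x. gegenbauer l n (g x))"
  by (rule continuous_on_compose2[of UNIV _ _ g])
     (auto intro!: continuous_at_imp_continuous_on DERIV_isCont gegenbauer_DERIV)

lemma continuous_on_gegenbauer': "continuous_on A (gegenbauer' l n)"
proof -
  obtain p where "\<forall>x. gegenbauer l n x = poly p x" using gegenbauer_poly by blast
  then have "gegenbauer l n = poly p" by auto
  then have "gegenbauer' l n = poly (pderiv p)" unfolding gegenbauer'_def
    by (metis DERIV_imp_deriv ext poly_DERIV)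
  then show ?thesis by (simp add: continuous_intros)
qed

lemma gegenbauer'_rec:
  "real (n + 2) * gegenbauer' l (n + 2) x =
     2 * (real n + 1 + l) * (gegenbauer l (n + 1) x + x * gegenbauer' l (n + 1) x)
     - (real n + 2 * l) * gegenbauer' l n x"
proof -
  have "((\<lambda>x. real (n + 2) * gegenbauer l (n + 2) x) has_real_derivative real (n + 2) * gegenbauer' l (n + 2) x) (at x)"
    by (rule DERIV_cmult gegenbauer_DERIV)+
  moreover have "((\<lambda>x. real (n + 2) * gegenbauer l (n + 2) x) has_real_derivative
      2 * (real n + 1 + l) * (gegenbauer l (n + 1) x + x * gegenbauer' l (n + 1) x)
     - (real n + 2 * l) * gegenbauer' l n x) (at x)"
    unfolding gegenbauer_rec
    by (auto intro!: derivative_eq_intros gegenbauer_DERIV simp: algebra_simps)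
  ultimately show ?thesis by (rule DERIV_unique)
qed

lemma gegenbauer'_0 [simp]: "gegenbauer' l 0 x = 0"
proof -
  have "gegenbauer l 0 = (\<lambda>x. 1)" by auto
  then show ?thesis by (simp add: gegenbauer'_def)
qed

lemma gegenbauer'_1 [simp]: "gegenbauer' l (Suc 0) x = 2 * l"
proof -
  have "gegenbauer l (Suc 0) = (\<lambda>x. 2 * l * x)" by auto
  then show ?thesis by (auto simp: gegenbauer'_def intro!: DERIV_imp_deriv derivative_eq_intros)
qed

text \<open>The differentiated recurrence contains only first derivatives; multiplied by 1 - x^2 it
  lets the two preceding instances be inserted, and a polynomial identity remains.\<close>

lemma gegenbauer'_eq:
  "(1 - x\<^sup>2) * gegenbauer' l (Suc n) x =
     - real (Suc n) * x * gegenbauer l (Suc n) x + (real n + 2 * l) * gegenbauer l n x"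
proof (induction n rule: less_induct)
  case (less n)
  consider "n = 0" | "n = 1" | m where "n = m + 2"
    by (metis add.commute add_2_eq_Suc' One_nat_def not0_implies_Suc)
  then show ?case
  proof cases
    case 2
    have r: "2 * gegenbauer l 2 x = 2 * (1 + l) * x * (2 * l * x) - 2 * l" 
      using gegenbauer_rec[of 0 l x] by (simp add: numeral_2_eq_2)
    have r': "2 * gegenbauer' l 2 x = 2 * (1 + l) * (2 * l * x + x * (2 * l))"
      using gegenbauer'_rec[of 0 l x] by (simp add: numeral_2_eq_2)
    have "2 * ((1 - x\<^sup>2) * gegenbauer' l 2 x) = 2 * (- 2 * x * gegenbauer l 2 x + (1 + 2 * l) * (2 * l * x))"
      using r r' by algebra
    then show ?thesis using 2 by (simp add: numeral_2_eq_2)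
  next
    case 3
    define c0 c1 c2 c3 where "c0 = gegenbauer l m x" "c1 = gegenbauer l (m + 1) x" "c2 = gegenbauer l (m + 2) x" "c3 = gegenbauer l (m + 3) x"
    define d1 d2 d3 where "d1 = gegenbauer' l (m + 1) x" "d2 = gegenbauer' l (m + 2) x" "d3 = gegenbauer' l (m + 3) x"
    define r where "r = real m"
    have 1: "(1 - x\<^sup>2) * d1 = - (r + 1) * x * c1 + (r + 2 * l) * c0"
      using less[of m] 3 by (simp add: c0_c1_c2_c3_def d1_d2_d3_def r_def)
    have 2: "(1 - x\<^sup>2) * d2 = - (r + 2) * x * c2 + (r + 1 + 2 * l) * c1"
      using less[of "m + 1"] 3 by (simp add: c0_c1_c2_c3_def d1_d2_d3_def r_def add.commute)
    have 4: "(r + 2) * c2 = 2 * (r + 1 + l) * x * c1 - (r + 2 * l) * c0"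
      using gegenbauer_rec[of m l x] by (simp add: c0_c1_c2_c3_def r_def add.commute)
    have 5: "(r + 3) * c3 = 2 * (r + 2 + l) * x * c2 - (r + 1 + 2 * l) * c1"
      using gegenbauer_rec[of "m + 1" l x] by (simp add: c0_c1_c2_c3_def r_def eval_nat_numeral add.commute)
    have 6: "(r + 3) * d3 = 2 * (r + 2 + l) * (c2 + x * d2) - (r + 1 + 2 * l) * d1"
      using gegenbauer'_rec[of "m + 1" l x] by (simp add: c0_c1_c2_c3_def d1_d2_d3_def r_def eval_nat_numeral add.commute)
    \<comment> \<open>The recurrences determine only (r + 3) c3 and (r + 3) d3, so the claim is
      proved with this factor and stays free of division.\<close>
    have "(r + 3) * ((1 - x\<^sup>2) * d3) = (r + 3) * (- (r + 3) * x * c3 + (r + 2 + 2 * l) * c2)"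
      using 1 2 4 5 6 by algebra
    moreover have "r + 3 \<noteq> 0" by (simp add: r_def add_nonneg_eq_0_iff)
    ultimately have "(1 - x\<^sup>2) * d3 = - (r + 3) * x * c3 + (r + 2 + 2 * l) * c2" by simp
    then show ?thesis using 3 by (simp add: c0_c1_c2_c3_def d1_d2_d3_def r_def eval_nat_numeral add.commute)
  qed (simp add: power2_eq_square algebra_simps)
qed

section \<open>Orthogonality\<close>

lemma Gamma_plus1_pos:
  fixes x :: real
  assumes "x > 0"
  shows "Gamma (x + 1) = x * Gamma x"
  using assms by (intro Gamma_plus1) (auto elim!: nonpos_Ints_cases)

lemma Gamma_pos_neq_0: "x > (0::real) \<Longrightarrow> Gamma x \<noteq> 0"
  using Gamma_real_pos[of x] by (metis less_irrefl)

lemma gegenbauer_h_pos: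
  assumes "l > 0"
  shows "gegenbauer_h l n > 0"
  unfolding gegenbauer_h_def using assms Gamma_real_pos[OF assms]
  by (intro mult_pos_pos divide_pos_pos Gamma_real_pos zero_less_power) auto

text \<open>The quotient of consecutive norms, cross-multiplied into the form that the induction for
  the square integrals produces.\<close>

lemma gegenbauer_h_Suc:
  assumes "l > 0"
  shows "gegenbauer_h l (Suc n) * (real (Suc n) * (real n + 1 + l)) =
     gegenbauer_h l n * ((real n + 2 * l) * (real n + l))"
proof -
  have 1: "Gamma (real n + 1 + 2 * l) = (real n + 2 * l) * Gamma (real n + 2 * l)"
    using Gamma_plus1_pos[of "real n + 2 * l"] assms by (simp add: add_ac)
  have 2: "Gamma (real n + 1 + 1) = (real n + 1) * Gamma (real n + 1)"
    using Gamma_plus1_pos[of "real n + 1"] by (simp add: add_ac)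
  have nz: "Gamma (real n + 1) \<noteq> 0" "Gamma l \<noteq> 0" "real n + 1 + l \<noteq> 0" "real n + l \<noteq> 0" "real n + 1 \<noteq> 0"
    using assms Gamma_pos_neq_0[of "real n + 1"] Gamma_pos_neq_0[of l] by auto
  have S: "real (Suc n) = real n + 1" by simp
  define A where "A = 2 powr (1 - 2 * l) * pi / (Gamma l)\<^sup>2"
  show ?thesis unfolding gegenbauer_h_def S 1 2 A_def[symmetric]
    using nz by (simp add: divide_simps)
qed

text \<open>The substitution x = 2 t - 1 gives 1 - x^2 = 4 t (1 - t), hence a Beta integral with
  both parameters l + 1/2; Legendre's duplication formula brings it to the form of
  \<open>gegenbauer_h\<close>.\<close>

lemma has_integral_gegenbauer_weight:
  assumes "l > 0"
  shows "((\<lambda>x. (1 - x\<^sup>2) powr (l - 1/2)) has_integral gegenbauer_h l 0) {-1..1}"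
proof -
  define B where "B = Beta (l + 1/2) (l + 1/2)"
  have "((\<lambda>t. t powr (l + 1/2 - 1) * (1 - t) powr (l + 1/2 - 1)) has_integral B) (cbox 0 1)"
    using has_integral_Beta_real[of "l + 1/2" "l + 1/2"] assms by (simp add: B_def)
  moreover have im: "(\<lambda>x. x * 2 - 1) ` {0..1::real} = {-1..1}"
    using image_affinity_atLeastAtMost[of 2 "-1" 0 "1::real"] by (simp add: mult.commute)
  ultimately have "((\<lambda>x. ((x + 1) / 2) powr (l - 1/2) * (1 - (x + 1) / 2) powr (l - 1/2)) has_integral 2 * B) {-1..1}"
    using has_integral_affinity[of _ B 0 "1::real" "1/2" "1/2"]
    by (fastforce simp add: im add_divide_distrib diff_divide_distrib algebra_simps)
  from has_integral_mult_right[OF this, of "4 powr (l - 1/2)"]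
  have "((\<lambda>x. (1 - x\<^sup>2) powr (l - 1/2)) has_integral 4 powr (l - 1/2) * (2 * B)) {-1..1}"
  proof (rule has_integral_eq[rotated])
    fix x :: real assume "x \<in> {-1..1}"
    then have "4 powr (l - 1/2) * (((x + 1) / 2) powr (l - 1/2) * (1 - (x + 1) / 2) powr (l - 1/2))
      = (4 * (((x + 1) / 2) * (1 - (x + 1) / 2))) powr (l - 1/2)"
      by (subst powr_mult powr_mult)+ auto
    also have "4 * (((x + 1) / 2) * (1 - (x + 1) / 2)) = 1 - x\<^sup>2"
      by (simp add: field_simps power2_eq_square)
    finally show "4 powr (l - 1/2) * (((x + 1) / 2) powr (l - 1/2) * (1 - (x + 1) / 2) powr (l - 1/2)) = (1 - x\<^sup>2) powr (l - 1/2)" .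
  qed
  also have "4 powr (l - 1/2) * (2 * B) = gegenbauer_h l 0"
  proof -
    have npi: "complex_of_real l \<notin> \<int>\<^sub>\<le>\<^sub>0" "complex_of_real l + 1/2 \<notin> \<int>\<^sub>\<le>\<^sub>0"
      using assms by (auto elim!: nonpos_Ints_cases simp: complex_eq_iff)
    have "complex_of_real (Gamma l * Gamma (l + 1/2)) = complex_of_real (exp ((1 - 2 * l) * ln 2) * sqrt pi * Gamma (2 * l))"
      using Gamma_legendre_duplication[OF npi] 
      by (simp flip: Gamma_complex_of_real exp_of_real)
    then have "Gamma l * Gamma (l + 1/2) = exp ((1 - 2 * l) * ln 2) * sqrt pi * Gamma (2 * l)"
      by (simp only: of_real_eq_iff)
    then have dup: "Gamma (l + 1/2) = 2 powr (1 - 2 * l) * sqrt pi * Gamma (2 * l) / Gamma l"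
      using Gamma_pos_neq_0[OF assms] by (simp add: powr_def nonzero_eq_divide_eq mult.commute)
    have p4: "4 powr (l - 1/2) * 2 powr (1 - 2 * l) = (1::real)"
    proof -
      have "(4::real) powr (l - 1/2) = (2 powr 2) powr (l - 1/2)" by simp
      also have "\<dots> = 2 powr (2 * l - 1)" by (subst powr_powr) (simp add: algebra_simps)
      finally show ?thesis by (simp flip: powr_add)
    qed
    have G1: "Gamma (2 * l + 1) = 2 * l * Gamma (2 * l)"
      using Gamma_plus1_pos[of "2 * l"] assms by (simp add: add_ac)
    have nz: "Gamma l \<noteq> 0" "Gamma (2 * l) \<noteq> 0" "l \<noteq> 0" using Gamma_pos_neq_0[of l] Gamma_pos_neq_0[of "2*l"] assms by auto
    have "4 powr (l - 1/2) * (2 * B) = (4 powr (l - 1/2) * 2 powr (1 - 2 * l)) * 2 powr (1 - 2 * l) * (sqrt pi)\<^sup>2 * Gamma (2 * l) ^ 2 / (Gamma l ^ 2 * (l * Gamma (2 * l)))"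
      unfolding B_def Beta_def using G1 by (simp add: dup power2_eq_square)
    also have "\<dots> = gegenbauer_h l 0" unfolding p4 gegenbauer_h_def using nz
      by (simp add: power2_eq_square)
    finally show ?thesis .
  qed
  finally show ?thesis .
qed

text \<open>For l < 1/2 the weight is unbounded at both endpoints, so continuity is no help there;
  an integrable weight times a bounded measurable function is integrable. The values are vectors
  because both real polynomials and the complex f are inserted.\<close>

lemma absolutely_integrable_gegenbauer_weight:
  fixes g :: "real \<Rightarrow> 'a::euclidean_space"
  assumes "l > 0" "continuous_on {-1..1} g"
  shows "(\<lambda>x. (1 - x\<^sup>2) powr (l - 1/2) *\<^sub>R g x) absolutely_integrable_on {-1..1}"
proof -
  have "bilinear (\<lambda>(a::'a) (r::real). r *\<^sub>R a)"
    by (auto simp: bilinear_def algebra_simps intro!: linearI)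
  moreover have "(\<lambda>x. (1 - x\<^sup>2) powr (l - 1/2)) absolutely_integrable_on {-1..1::real}"
    using has_integral_gegenbauer_weight[OF assms(1)]
    by (intro nonnegative_absolutely_integrable_1) (auto simp: integrable_on_def)
  moreover have "g \<in> borel_measurable (lebesgue_on {-1..1})"
    using assms(2) by (intro continuous_imp_measurable_on_sets_lebesgue) auto
  moreover have "bounded (g ` {-1..1})"
    using assms(2) by (intro compact_imp_bounded compact_continuous_image) auto
  ultimately show ?thesis
    by (intro absolutely_integrable_bounded_measurable_product[where h = "\<lambda>a r. r *\<^sub>R a"]) auto
qed

section \<open>Differential equation and orthogonality\<close>

lemma gegenbauer'_eq2:
  "(1 - x\<^sup>2) * gegenbauer' l n x =
     (real n + 2 * l) * x * gegenbauer l n x - real (Suc n) * gegenbauer l (Suc n) x"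
proof (cases n)
  case (Suc k)
  show ?thesis using gegenbauer_rec[of k l x] unfolding Suc gegenbauer'_eq
    by (simp add: algebra_simps)
qed simp

text \<open>This is (1 - x^2) y'' - (2 l + 1) x y' + n (n + 2 l) y = 0, written as a derivative of
  (1 - x^2) y' so that second derivatives need not be named.\<close>

lemma gegenbauer_ode:
  assumes "\<bar>x\<bar> < 1"
  shows "((\<lambda>x. (1 - x\<^sup>2) * gegenbauer' l n x) has_real_derivative
    (2 * l - 1) * x * gegenbauer' l n x - real n * (real n + 2 * l) * gegenbauer l n x) (at x)"
proof (cases n)
  case (Suc k)
  have nz: "1 - x\<^sup>2 \<noteq> 0" using assms by (simp add: abs_square_less_1[symmetric])
  \<comment> \<open>The two first-order relations together eliminate the undifferentiated C_k;
    cancelling 1 - x^2 is where |x| < 1 enters.\<close>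
  have "(1 - x\<^sup>2) * (x * gegenbauer' l (Suc k) x - gegenbauer' l k x) = (1 - x\<^sup>2) * (real (Suc k) * gegenbauer l (Suc k) x)"
    using gegenbauer'_eq[of x l k] gegenbauer'_eq2[of x l k] by algebra
  then have I3: "gegenbauer' l k x = x * gegenbauer' l (Suc k) x - real (Suc k) * gegenbauer l (Suc k) x"
    using nz by simp
  have "((\<lambda>x. - real (Suc k) * x * gegenbauer l (Suc k) x + (real k + 2 * l) * gegenbauer l k x) has_real_derivative
     - real (Suc k) * (gegenbauer l (Suc k) x + x * gegenbauer' l (Suc k) x) + (real k + 2 * l) * gegenbauer' l k x) (at x)"
    by (auto intro!: derivative_eq_intros gegenbauer_DERIV simp: algebra_simps)
  then show ?thesis unfolding Suc gegenbauer'_eq I3 by (simp add: algebra_simps)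
qed simp

definition gegenbauer_integral :: "real \<Rightarrow> (real \<Rightarrow> real) \<Rightarrow> real" where
  "gegenbauer_integral l g = integral {-1..1} (\<lambda>x. (1 - x\<^sup>2) powr (l - 1/2) * g x)"

lemma has_integral_gegenbauer_integral:
  assumes "l > 0" "continuous_on {-1..1} g"
  shows "((\<lambda>x. (1 - x\<^sup>2) powr (l - 1/2) * g x) has_integral gegenbauer_integral l g) {-1..1}"
  using absolutely_integrable_gegenbauer_weight[OF assms] unfolding gegenbauer_integral_def
  by (auto simp: absolutely_integrable_on_def)

lemma gegenbauer_integral_lincomb:
  assumes "l > 0" "continuous_on {-1..1} g" "continuous_on {-1..1} h"
  shows "gegenbauer_integral l (\<lambda>x. a * g x + b * h x) = a * gegenbauer_integral l g + b * gegenbauer_integral l h"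
proof -
  have "((\<lambda>x. a * ((1 - x\<^sup>2) powr (l - 1/2) * g x) + b * ((1 - x\<^sup>2) powr (l - 1/2) * h x)) has_integral
     a * gegenbauer_integral l g + b * gegenbauer_integral l h) {-1..1}"
    by (intro has_integral_add has_integral_mult_right has_integral_gegenbauer_integral assms)
  then show ?thesis unfolding gegenbauer_integral_def
    by (intro integral_unique) (simp add: algebra_simps)
qed

text \<open>Sturm-Liouville argument: \<open>F\<close> is the weighted Wronskian of C_m and C_n. It
  vanishes at both endpoints, and its derivative is the difference \<open>c\<close> of the
  eigenvalues times the integrand.\<close>

lemma gegenbauer_orthogonal:
  assumes "l > 0" "m \<noteq> n"
  shows "gegenbauer_integral l (\<lambda>x. gegenbauer l m x * gegenbauer l n x) = 0"
proof -
  define c where "c = real n * (real n + 2 * l) - real m * (real m + 2 * l)"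
  define F where "F x = (1 - x\<^sup>2) powr (l + 1/2) * (gegenbauer' l m x * gegenbauer l n x - gegenbauer l m x * gegenbauer' l n x)" for x
  have 1: "((\<lambda>x. c * ((1 - x\<^sup>2) powr (l - 1/2) * (gegenbauer l m x * gegenbauer l n x))) has_integral F 1 - F (-1)) {-1..1}"
  proof (rule fundamental_theorem_of_calculus_interior)
    \<comment> \<open>Differentiability may fail at the endpoints, but the positive exponent l + 1/2
      keeps \<open>F\<close> continuous there, which suffices for the interior form of the
      fundamental theorem.\<close>
    have "continuous_on {-1..1::real} (\<lambda>x. (1 - x\<^sup>2) powr (l + 1/2))"
    proof (rule continuous_on_powr')
      show "\<forall>x\<in>{- 1..1::real}. 0 \<le> 1 - x\<^sup>2 \<and> (1 - x\<^sup>2 = 0 \<longrightarrow> 0 < l + 1 / 2)"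
      proof
        fix x :: real assume "x \<in> {-1..1}"
        then have "x\<^sup>2 \<le> 1" by (auto simp: abs_square_le_1 abs_le_iff)
        then show "0 \<le> 1 - x\<^sup>2 \<and> (1 - x\<^sup>2 = 0 \<longrightarrow> 0 < l + 1 / 2)" using assms by linarith
      qed
    qed (intro continuous_intros)+
    then show "continuous_on {-1..1} F" unfolding F_def
      by (rule continuous_on_mult) (intro continuous_intros continuous_on_gegenbauer')
  next
    fix x :: real assume x: "x \<in> {-1<..<1}"
    then have pos: "1 - x\<^sup>2 > 0" using abs_square_less_1[of x] by auto
    have x1: "\<bar>x\<bar> < 1" using x by auto
    \<comment> \<open>The product rule in bare variables: t stands for 1 - x^2, w for the weight, k
      for 2 l - 1, and M, N for the eigenvalues. The terms with k cancel.\<close>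
    have alg: "- k * x * w / t * (t * dm * cn - cm * (t * dn)) +
        ((k * x * dm - M * cm) * cn + dn * (t * dm) - (dm * (t * dn) + (k * x * dn - N * cn) * cm)) * w
        = (N - M) * (w * (cm * cn))" if "t \<noteq> 0" for k w t dm dn cm cn M N :: real
    proof -
      have "- k * x * w / t * (t * dm * cn - cm * (t * dn)) = - k * x * w / t * (t * (dm * cn - cm * dn))"
        by (simp add: algebra_simps)
      also have "\<dots> = - k * x * w * (dm * cn - cm * dn)" using that by simp
      finally show ?thesis by (simp add: algebra_simps)
    qed
    define w where "w = (1 - x\<^sup>2) powr (l - 1/2)"
    have w': "((\<lambda>x. (1 - x\<^sup>2) powr (l - 1/2)) has_real_derivative - (2 * l - 1) * x * w / (1 - x\<^sup>2)) (at x)"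
    proof (rule DERIV_cong)
      have "((\<lambda>x. 1 - x\<^sup>2) has_real_derivative - (2 * x)) (at x)"
        by (auto intro!: derivative_eq_intros)
      from DERIV_fun_powr[OF this pos, of "l - 1/2"]
      show "((\<lambda>x. (1 - x\<^sup>2) powr (l - 1/2)) has_real_derivative (l - 1/2) * (1 - x\<^sup>2) powr (l - 1/2 - 1) * - (2 * x)) (at x)"
        by simp
      show "(l - 1/2) * (1 - x\<^sup>2) powr (l - 1/2 - 1) * - (2 * x) = - (2 * l - 1) * x * w / (1 - x\<^sup>2)"
        using pos powr_diff[of "1 - x\<^sup>2" "l - 1/2" 1] unfolding w_def by (simp add: algebra_simps)
    qed
    have "((\<lambda>x. (1 - x\<^sup>2) powr (l - 1/2) * (((1 - x\<^sup>2) * gegenbauer' l m x) * gegenbauer l n x - gegenbauer l m x * ((1 - x\<^sup>2) * gegenbauer' l n x)))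
       has_real_derivative c * (w * (gegenbauer l m x * gegenbauer l n x))) (at x)"
      using pos
      by (intro DERIV_cong[OF DERIV_mult[OF w' DERIV_diff[OF DERIV_mult[OF gegenbauer_ode[OF x1] gegenbauer_DERIV]
             DERIV_mult[OF gegenbauer_DERIV gegenbauer_ode[OF x1]]]]])
         (unfold w_def[symmetric] c_def, rule alg, simp)
    then have "(F has_real_derivative c * (w * (gegenbauer l m x * gegenbauer l n x))) (at x)"
    proof (rule has_field_derivative_transform_within_open[where S = "{-1<..<1}"])
      fix y :: real assume "y \<in> {-1<..<1}"
      then have "1 - y\<^sup>2 > 0" using abs_square_less_1[of y] by auto
      then have e: "(1 - y\<^sup>2) powr (l + 1/2) = (1 - y\<^sup>2) powr (l - 1/2) * (1 - y\<^sup>2)"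
        using powr_add[of "1 - y\<^sup>2" "l - 1/2" 1] by (simp add: add.commute)
      show "(1 - y\<^sup>2) powr (l - 1/2) * (((1 - y\<^sup>2) * gegenbauer' l m y) * gegenbauer l n y - gegenbauer l m y * ((1 - y\<^sup>2) * gegenbauer' l n y)) = F y"
        unfolding F_def e by (simp only: right_diff_distrib left_diff_distrib mult_ac)
    qed (use x in auto)
    then show "(F has_vector_derivative c * ((1 - x\<^sup>2) powr (l - 1/2) * (gegenbauer l m x * gegenbauer l n x))) (at x)"
      by (simp add: w_def has_real_derivative_iff_has_vector_derivative)
  qed auto
  have 2: "((\<lambda>x. c * ((1 - x\<^sup>2) powr (l - 1/2) * (gegenbauer l m x * gegenbauer l n x))) has_integral
     c * gegenbauer_integral l (\<lambda>x. gegenbauer l m x * gegenbauer l n x)) {-1..1}"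
    by (intro has_integral_mult_right has_integral_gegenbauer_integral assms continuous_intros)
  have "F 1 - F (-1) = 0" by (simp add: F_def)
  with has_integral_unique[OF 1 2] have "c * gegenbauer_integral l (\<lambda>x. gegenbauer l m x * gegenbauer l n x) = 0"
    by simp
  moreover have "c = (real n - real m) * (real n + real m + 2 * l)"
    by (simp add: c_def algebra_simps)
  ultimately show ?thesis using assms by (auto simp: add_nonneg_pos)
qed

text \<open>The integral X of x C_(n+1) C_n against the weight is computed twice, expanding x
  C_(n+1) and x C_n by the recurrence. Orthogonality leaves one square each time, so consecutive
  norms are related.\<close>

lemma gegenbauer_square_integral:
  assumes "l > 0"
  shows "gegenbauer_integral l (\<lambda>x. gegenbauer l n x * gegenbauer l n x) = gegenbauer_h l n"
proof (induction n)
  case 0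
  show ?case using has_integral_gegenbauer_weight[OF assms]
    by (simp add: gegenbauer_integral_def integral_unique)
next
  case (Suc n)
  let ?I = "gegenbauer_integral l" and ?C = "gegenbauer l"
  have lin: "?I (\<lambda>x. a * (?C i x * ?C j x) + b * (?C p x * ?C q x)) =
      a * ?I (\<lambda>x. ?C i x * ?C j x) + b * ?I (\<lambda>x. ?C p x * ?C q x)" for a b i j p q
    by (intro gegenbauer_integral_lincomb assms continuous_intros)
  define X where "X = ?I (\<lambda>x. x * ?C (Suc n) x * ?C n x)"
  have one: "?I (\<lambda>x. a * (x * ?C (Suc n) x * ?C n x)) = a * X" for a
    using gegenbauer_integral_lincomb[OF assms, of "\<lambda>x. x * ?C (Suc n) x * ?C n x" "\<lambda>x. 0" a 0]
    by (simp add: X_def continuous_intros)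
  have e1: "2 * (real n + 1 + l) * X = (real n + 2 * l) * gegenbauer_h l n"
  proof -
    have "2 * (real n + 1 + l) * X = ?I (\<lambda>x. (2 * (real n + 1 + l)) * (x * ?C (Suc n) x * ?C n x))"
      by (simp only: one)
    also have "\<dots> = ?I (\<lambda>x. real (n + 2) * (?C (n + 2) x * ?C n x) + (real n + 2 * l) * (?C n x * ?C n x))"
    proof (intro arg_cong[of _ _ ?I] ext)
      show "2 * (real n + 1 + l) * (x * ?C (Suc n) x * ?C n x) = real (n + 2) * (?C (n + 2) x * ?C n x) + (real n + 2 * l) * (?C n x * ?C n x)" for x
      proof -
        have r: "2 * (real n + 1 + l) * x * ?C (Suc n) x = real (n + 2) * ?C (n + 2) x + (real n + 2 * l) * ?C n x"
          unfolding gegenbauer_rec by simp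
        have "2 * (real n + 1 + l) * (x * ?C (Suc n) x * ?C n x) = 2 * (real n + 1 + l) * x * ?C (Suc n) x * ?C n x"
          by (simp only: mult.assoc)
        also have "\<dots> = real (n + 2) * (?C (n + 2) x * ?C n x) + (real n + 2 * l) * (?C n x * ?C n x)"
          unfolding r by (simp only: distrib_right mult.assoc)
        finally show ?thesis .
      qed
    qed
    finally show ?thesis using gegenbauer_orthogonal[OF assms, of "n+2" n] unfolding lin Suc.IH by simp
  qed
  have e2: "2 * (real n + l) * X = real (Suc n) * ?I (\<lambda>x. ?C (Suc n) x * ?C (Suc n) x)"
  proof -
    \<comment> \<open>For n = 0 the truncated subtraction makes k = 0; the coefficient in front is
      then set to 0, since C_0 has no lower neighbour.\<close>
    define k where "k = n - 1"
    have "2 * (real n + l) * X = ?I (\<lambda>x. (2 * (real n + l)) * (x * ?C (Suc n) x * ?C n x))"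
      by (simp only: one)
    also have "\<dots> = ?I (\<lambda>x. real (Suc n) * (?C (Suc n) x * ?C (Suc n) x) + (if n = 0 then 0 else real n - 1 + 2 * l) * (?C k x * ?C (Suc n) x))"
    proof (intro arg_cong[of _ _ ?I] ext)
      fix x
      show "(2 * (real n + l)) * (x * ?C (Suc n) x * ?C n x) = real (Suc n) * (?C (Suc n) x * ?C (Suc n) x) + (if n = 0 then 0 else real n - 1 + 2 * l) * (?C k x * ?C (Suc n) x)"
      proof (cases n)
        case (Suc j)
        have r: "2 * (real j + 1 + l) * x * ?C (Suc j) x = real (j + 2) * ?C (j + 2) x + (real j + 2 * l) * ?C j x"
          unfolding gegenbauer_rec by simp
        have "2 * (real j + 1 + l) * (x * ?C (j + 2) x * ?C (Suc j) x) = 2 * (real j + 1 + l) * x * ?C (Suc j) x * ?C (j + 2) x"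
          by (simp only: mult_ac)
        also have "\<dots> = real (j + 2) * (?C (j + 2) x * ?C (j + 2) x) + (real j + 2 * l) * (?C j x * ?C (j + 2) x)"
          unfolding r by (simp only: distrib_right mult.assoc)
        finally show ?thesis unfolding k_def Suc by (simp add: add_ac)
      qed simp
    qed
    finally show ?thesis using gegenbauer_orthogonal[OF assms, of k "Suc n"] unfolding lin by (simp add: k_def)
  qed
  have nz: "real (Suc n) * (real n + 1 + l) \<noteq> 0" using assms by auto
  define Y where "Y = ?I (\<lambda>x. ?C (Suc n) x * ?C (Suc n) x)"
  have "Y * (real (Suc n) * (real n + 1 + l)) = (2 * (real n + l) * X) * (real n + 1 + l)"
    unfolding e2 Y_def by (simp only: mult_ac)
  also have "\<dots> = (2 * (real n + 1 + l) * X) * (real n + l)"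
    by (simp only: mult_ac)
  also have "\<dots> = gegenbauer_h l (Suc n) * (real (Suc n) * (real n + 1 + l))"
    unfolding e1 gegenbauer_h_Suc[OF assms] by (simp only: mult_ac)
  finally have "?I (\<lambda>x. ?C (Suc n) x * ?C (Suc n) x) * (real (Suc n) * (real n + 1 + l))
      = gegenbauer_h l (Suc n) * (real (Suc n) * (real n + 1 + l))" unfolding Y_def .
  then show ?case using nz by simp
qed

section \<open>Functions of the second kind\<close>

text \<open>Up to sign the coefficients are the binomial coefficients of -a, so this is absolute
  convergence of a binomial series. Every summability claim about Q_n reduces to it.\<close>

lemma summable_pochhammer_fact:
  fixes a r :: real
  assumes "0 \<le> r" "r < 1"
  shows "summable (\<lambda>k. \<bar>pochhammer a k / fact k\<bar> * r ^ k)"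
proof -
  have "ereal (norm r) < conv_radius (\<lambda>n. (- a) gchoose n)"
    using assms by (simp add: conv_radius_gchoose)
  from abs_summable_in_conv_radius[OF this] show ?thesis
    using assms by (simp add: gbinomial_pochhammer abs_mult)
qed

text \<open>Up to the factor in v, this is the connection coefficient of C_n in the Chebyshev polynomial U_(n+2k),
  since 1/(z - x) is twice the sum of U_m(x) v^(m+1).\<close>

definition gegenbauer_Q_coeff :: "real \<Rightarrow> nat \<Rightarrow> nat \<Rightarrow> real" where
  "gegenbauer_Q_coeff l n k = 2 * fact (n + k) * pochhammer (1 - l) k * (real n + l) / (fact k * pochhammer l (n + k + 1))"

definition gegenbauer_Q :: "real \<Rightarrow> nat \<Rightarrow> complex \<Rightarrow> complex" where
  "gegenbauer_Q l n v = v ^ (n + 1) * (\<Sum>k. complex_of_real (gegenbauer_Q_coeff l n k) * (v\<^sup>2) ^ k)"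

lemma fact_le_pochhammer:
  assumes "(l::real) > 0"
  shows "l * fact n \<le> pochhammer l (n + 1)"
proof (induction n)
  case (Suc n)
  have "l * fact (Suc n) = (l * fact n) * (real n + 1)" by (simp add: algebra_simps)
  also have "\<dots> \<le> pochhammer l (n + 1) * (l + real n + 1)"
    using Suc assms by (intro mult_mono) (auto intro!: pochhammer_nonneg)
  finally show ?case by (simp add: pochhammer_Suc[of l "Suc n"] algebra_simps)
qed simp

text \<open>The factor (n + k)! / (l)_(n+k+1) is at most 1/l, which removes the coupling of n and k:
  what depends on k is a binomial series common to all n.\<close>

lemma abs_gegenbauer_Q_coeff_le:
  assumes "l > 0"
  shows "\<bar>gegenbauer_Q_coeff l n k\<bar> \<le> 2 * (real n + l) / l * \<bar>pochhammer (1 - l) k / fact k\<bar>"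
proof -
  have p: "pochhammer l (n + k + 1) > 0" using assms by (intro pochhammer_pos)
  have "\<bar>gegenbauer_Q_coeff l n k\<bar> = 2 * (real n + l) * \<bar>pochhammer (1 - l) k / fact k\<bar> * (fact (n + k) / pochhammer l (n + k + 1))"
    using p assms by (simp add: gegenbauer_Q_coeff_def abs_mult)
  also have "\<dots> \<le> 2 * (real n + l) * \<bar>pochhammer (1 - l) k / fact k\<bar> * (1 / l)"
    using p assms fact_le_pochhammer[OF assms, of "n+k"]
    by (intro mult_left_mono) (auto simp: field_simps)
  finally show ?thesis by (simp only: mult_1_right mult_ac times_divide_eq_right times_divide_eq_left)
qed

lemma summable_abs_gegenbauer_Q_coeff:
  assumes "l > 0" "0 \<le> r" "r < 1"
  shows "summable (\<lambda>k. \<bar>gegenbauer_Q_coeff l n k\<bar> * r ^ k)"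
proof (rule summable_comparison_test'[OF summable_mult[OF summable_pochhammer_fact[OF assms(2,3), of "1 - l"], of "2 * (real n + l) / l"]])
  fix k show "norm (\<bar>gegenbauer_Q_coeff l n k\<bar> * r ^ k) \<le> 2 * (real n + l) / l * (\<bar>pochhammer (1 - l) k / fact k\<bar> * r ^ k)"
    using mult_right_mono[OF abs_gegenbauer_Q_coeff_le[OF assms(1), of n k], of "r ^ k"] assms
    by (simp add: mult.assoc abs_mult)
qed

lemma sums_gegenbauer_Q_series:
  assumes "l > 0" "norm v < 1"
  shows "(\<lambda>k. complex_of_real (gegenbauer_Q_coeff l n k) * (v\<^sup>2) ^ k) sums (\<Sum>k. complex_of_real (gegenbauer_Q_coeff l n k) * (v\<^sup>2) ^ k)"
proof (rule summable_sums, rule summable_norm_cancel)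
  have "norm v ^ 2 < 1" using assms by (simp add: power_less_one_iff)
  from summable_abs_gegenbauer_Q_coeff[OF assms(1) _ this]
  show "summable (\<lambda>k. norm (complex_of_real (gegenbauer_Q_coeff l n k) * (v\<^sup>2) ^ k))"
    by (simp add: norm_mult norm_power)
qed

definition gegenbauer_Q_bound :: "real \<Rightarrow> real \<Rightarrow> real" where
  "gegenbauer_Q_bound l r = (\<Sum>k. \<bar>pochhammer (1 - l) k / fact k\<bar> * (r\<^sup>2) ^ k)"

lemma norm_gegenbauer_Q_le:
  assumes "l > 0" "norm v \<le> r" "r < 1"
  shows "norm (gegenbauer_Q l n v) \<le> 2 * (real n + l) / l * r ^ (n + 1) * gegenbauer_Q_bound l r"
proof -
  have r: "0 \<le> r" "r\<^sup>2 < 1" using assms norm_ge_zero[of v]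
    by (linarith, simp add: power_less_one_iff order_trans[OF norm_ge_zero])
  have v: "norm v < 1" using assms by simp
  note sp = summable_pochhammer_fact[OF _ r(2), of "1 - l"]
  have s: "summable (\<lambda>k. norm (complex_of_real (gegenbauer_Q_coeff l n k) * (v\<^sup>2) ^ k))"
    using summable_abs_gegenbauer_Q_coeff[OF assms(1), of "norm v ^ 2" n] v
    by (simp add: norm_mult norm_power power_less_one_iff)
  have "norm (\<Sum>k. complex_of_real (gegenbauer_Q_coeff l n k) * (v\<^sup>2) ^ k) \<le> (\<Sum>k. norm (complex_of_real (gegenbauer_Q_coeff l n k) * (v\<^sup>2) ^ k))"
    by (rule summable_norm[OF s])
  also have "\<dots> \<le> (\<Sum>k. 2 * (real n + l) / l * (\<bar>pochhammer (1 - l) k / fact k\<bar> * (r\<^sup>2) ^ k))"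
  proof (rule suminf_le[OF _ s])
    fix k
    have "norm (complex_of_real (gegenbauer_Q_coeff l n k) * (v\<^sup>2) ^ k) = \<bar>gegenbauer_Q_coeff l n k\<bar> * ((norm v)\<^sup>2) ^ k"
      by (simp add: norm_mult norm_power)
    also have "\<dots> \<le> (2 * (real n + l) / l * \<bar>pochhammer (1 - l) k / fact k\<bar>) * (r\<^sup>2) ^ k"
      using abs_gegenbauer_Q_coeff_le[OF assms(1), of n k] assms
      by (intro mult_mono power_mono) auto
    finally show "norm (complex_of_real (gegenbauer_Q_coeff l n k) * (v\<^sup>2) ^ k) \<le> 2 * (real n + l) / l * (\<bar>pochhammer (1 - l) k / fact k\<bar> * (r\<^sup>2) ^ k)"
      by (simp only: mult.assoc)
  qed (intro summable_mult sp, simp)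
  also have "\<dots> = 2 * (real n + l) / l * gegenbauer_Q_bound l r"
    unfolding gegenbauer_Q_bound_def by (rule suminf_mult) (intro sp, simp)
  finally have A: "norm (\<Sum>k. complex_of_real (gegenbauer_Q_coeff l n k) * (v\<^sup>2) ^ k) \<le> 2 * (real n + l) / l * gegenbauer_Q_bound l r" .
  have "norm (gegenbauer_Q l n v) = norm v ^ (n + 1) * norm (\<Sum>k. complex_of_real (gegenbauer_Q_coeff l n k) * (v\<^sup>2) ^ k)"
    by (simp only: gegenbauer_Q_def norm_mult norm_power)
  also have "\<dots> \<le> r ^ (n + 1) * (2 * (real n + l) / l * gegenbauer_Q_bound l r)"
    using A assms r by (intro mult_mono power_mono) auto
  finally show ?thesis by (simp only: mult_ac)
qed

text \<open>Since 2 z = v + 1/v, multiplying Q_n by 2 z adds neighbouring coefficients. The claims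
  are the general coefficient, the lowest one, and n = 0, where no Q_(n-1) exists. The divisors undo
  the factor n + l built into each coefficient.\<close>

lemma gegenbauer_Q_coeff_rec:
  assumes "l > 0"
  shows "gegenbauer_Q_coeff l (Suc n) k + gegenbauer_Q_coeff l (Suc n) (Suc k) =
     (real n + 1) / (real n + l) * gegenbauer_Q_coeff l n (Suc k) + (real n + 1 + 2 * l) / (real n + 2 + l) * gegenbauer_Q_coeff l (n + 2) k"
  and "gegenbauer_Q_coeff l (Suc n) 0 = (real n + 1) / (real n + l) * gegenbauer_Q_coeff l n 0"
  and "gegenbauer_Q_coeff l 0 k + gegenbauer_Q_coeff l 0 (Suc k) = 2 * l / (1 + l) * gegenbauer_Q_coeff l 1 k"
proof -
  have nz: "real n + l \<noteq> 0" "l \<noteq> 0" "real n + 2 + l \<noteq> 0" "1 + l \<noteq> 0"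
    using assms by auto
  define p where "p = pochhammer l (n + k + 1)"
  define q where "q = pochhammer (1 - l) k"
  define F where "F = (fact (n + k) :: real)"
  define G where "G = (fact k :: real)"
  define a where "a = real n"
  define b where "b = real k"
  have pz: "p \<noteq> 0" "F \<noteq> 0" "G \<noteq> 0" "a + l \<noteq> 0" "l \<noteq> 0" "a + 2 + l \<noteq> 0" "b + 1 \<noteq> 0" "l + a + b + 1 \<noteq> 0" "l + a + b + 2 \<noteq> 0"
    using assms pochhammer_pos[OF assms, of "n+k+1"] by (auto simp: p_def F_def G_def a_def b_def add_nonneg_eq_0_iff add_pos_nonneg)
  have e: "gegenbauer_Q_coeff l (Suc n) k = 2 * ((a + b + 1) * F) * q * (a + 1 + l) / (G * (p * (l + a + b + 1)))"
    "gegenbauer_Q_coeff l (Suc n) (Suc k) = 2 * ((a + b + 2) * (a + b + 1) * F) * (q * (1 - l + b)) * (a + 1 + l) / (((b + 1) * G) * (p * (l + a + b + 1) * (l + a + b + 2)))"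
    "gegenbauer_Q_coeff l n (Suc k) = 2 * ((a + b + 1) * F) * (q * (1 - l + b)) * (a + l) / (((b + 1) * G) * (p * (l + a + b + 1)))"
    "gegenbauer_Q_coeff l (n + 2) k = 2 * ((a + b + 2) * (a + b + 1) * F) * q * (a + 2 + l) / (G * (p * (l + a + b + 1) * (l + a + b + 2)))"
    unfolding gegenbauer_Q_coeff_def p_def q_def F_def G_def a_def b_def
    by (simp_all add: pochhammer_Suc numeral_2_eq_2 algebra_simps)
  show "gegenbauer_Q_coeff l (Suc n) k + gegenbauer_Q_coeff l (Suc n) (Suc k) =
     (real n + 1) / (real n + l) * gegenbauer_Q_coeff l n (Suc k) + (real n + 1 + 2 * l) / (real n + 2 + l) * gegenbauer_Q_coeff l (n + 2) k"
    unfolding e a_def[symmetric] using pz by (simp add: divide_simps) algebra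
  show "gegenbauer_Q_coeff l (Suc n) 0 = (real n + 1) / (real n + l) * gegenbauer_Q_coeff l n 0"
    using nz pochhammer_pos[OF assms, of "Suc n"] assms
    by (simp add: gegenbauer_Q_coeff_def pochhammer_Suc divide_simps) algebra
  define p' where "p' = pochhammer l (k + 1)"
  have pz': "p' \<noteq> 0" "l + b + 1 \<noteq> 0" "1 + l \<noteq> 0"
    using assms pochhammer_pos[OF assms, of "k+1"] by (auto simp: p'_def b_def add_nonneg_eq_0_iff add_pos_nonneg)
  have e': "gegenbauer_Q_coeff l 0 k = 2 * G * q * l / (G * p')"
    "gegenbauer_Q_coeff l 0 (Suc k) = 2 * ((b + 1) * G) * (q * (1 - l + b)) * l / (((b + 1) * G) * (p' * (l + b + 1)))"
    "gegenbauer_Q_coeff l 1 k = 2 * ((b + 1) * G) * q * (1 + l) / (G * (p' * (l + b + 1)))"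
    unfolding gegenbauer_Q_coeff_def p'_def q_def G_def b_def
    by (simp_all add: pochhammer_Suc algebra_simps)
  show "gegenbauer_Q_coeff l 0 k + gegenbauer_Q_coeff l 0 (Suc k) = 2 * l / (1 + l) * gegenbauer_Q_coeff l 1 k"
    unfolding e' using pz pz' by (simp add: divide_simps) algebra
qed

text \<open>The recurrence is inhomogeneous only at n = 0: half the leading coefficient 2 of Q_0 is
  the 1 that later becomes the numerator of the Cauchy kernel.\<close>

lemma gegenbauer_Q_rec:
  assumes "l > 0" "norm v < 1" "v \<noteq> 0"
  defines "z \<equiv> (v + 1 / v) / 2"
  shows "z * gegenbauer_Q l 0 v = 1 + complex_of_real (l / (1 + l)) * gegenbauer_Q l 1 v"
  and "z * gegenbauer_Q l (Suc n) v = complex_of_real ((real n + 1) / (2 * (real n + l))) * gegenbauer_Q l n v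
         + complex_of_real ((real n + 1 + 2 * l) / (2 * (real n + 2 + l))) * gegenbauer_Q l (n + 2) v"
proof -
  define S where "S n = (\<Sum>k. complex_of_real (gegenbauer_Q_coeff l n k) * (v\<^sup>2) ^ k)" for n
  have S: "(\<lambda>k. complex_of_real (gegenbauer_Q_coeff l n k) * (v\<^sup>2) ^ k) sums S n" for n
    unfolding S_def by (rule sums_gegenbauer_Q_series[OF assms(1,2)])
  have S': "(\<lambda>k. complex_of_real (gegenbauer_Q_coeff l n (Suc k)) * (v\<^sup>2) ^ Suc k) sums (S n - gegenbauer_Q_coeff l n 0)" for n
    using S[of n] by (subst sums_Suc_iff) simp
  have main: "(\<lambda>k. complex_of_real (gegenbauer_Q_coeff l n k + gegenbauer_Q_coeff l n (Suc k)) * (v\<^sup>2) ^ Suc k) sums (v\<^sup>2 * S n + (S n - gegenbauer_Q_coeff l n 0))" for n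
    using sums_add[OF sums_mult[OF S[of n], of "v\<^sup>2"] S'[of n]] by (simp add: algebra_simps)
  have J: "gegenbauer_Q l n v = v ^ (n + 1) * S n" for n by (simp add: gegenbauer_Q_def S_def)
  have "(\<lambda>k. complex_of_real (2 * l / (1 + l) * gegenbauer_Q_coeff l 1 k) * (v\<^sup>2) ^ Suc k) sums (complex_of_real (2 * l / (1 + l)) * v\<^sup>2 * S 1)"
    using sums_mult[OF S[of 1], of "complex_of_real (2 * l / (1 + l)) * v\<^sup>2"] by (simp add: algebra_simps)
  with main[of 0] have "v\<^sup>2 * S 0 + (S 0 - gegenbauer_Q_coeff l 0 0) = complex_of_real (2 * l / (1 + l)) * v\<^sup>2 * S 1"
    unfolding gegenbauer_Q_coeff_rec(3)[OF assms(1)] by (rule sums_unique2)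
  moreover have "gegenbauer_Q_coeff l 0 0 = 2" using assms(1) by (simp add: gegenbauer_Q_coeff_def)
  moreover have "complex_of_real (2 * l / (1 + l)) = 2 * complex_of_real (l / (1 + l))" by simp
  ultimately have "(v\<^sup>2 + 1) * S 0 = 2 + 2 * complex_of_real (l / (1 + l)) * v\<^sup>2 * S 1" by (simp add: algebra_simps)
  then show "z * gegenbauer_Q l 0 v = 1 + complex_of_real (l / (1 + l)) * gegenbauer_Q l 1 v"
    unfolding J z_def using assms(3) by (simp add: field_simps power2_eq_square)
  define A where "A = complex_of_real ((real n + 1) / (real n + l))"
  define B where "B = complex_of_real ((real n + 1 + 2 * l) / (real n + 2 + l))"
  have "(\<lambda>k. complex_of_real ((real n + 1) / (real n + l) * gegenbauer_Q_coeff l n (Suc k) + (real n + 1 + 2 * l) / (real n + 2 + l) * gegenbauer_Q_coeff l (n + 2) k) * (v\<^sup>2) ^ Suc k)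
     sums (A * (S n - gegenbauer_Q_coeff l n 0) + B * v\<^sup>2 * S (n + 2))"
    using sums_add[OF sums_mult[OF S'[of n], of A] sums_mult[OF S[of "n+2"], of "B * v\<^sup>2"]]
    by (simp add: algebra_simps A_def B_def)
  with main[of "Suc n"] have "v\<^sup>2 * S (Suc n) + (S (Suc n) - gegenbauer_Q_coeff l (Suc n) 0) = A * (S n - gegenbauer_Q_coeff l n 0) + B * v\<^sup>2 * S (n + 2)"
    unfolding gegenbauer_Q_coeff_rec(1)[OF assms(1)] by (rule sums_unique2)
  moreover have "complex_of_real (gegenbauer_Q_coeff l (Suc n) 0) = A * gegenbauer_Q_coeff l n 0"
    unfolding gegenbauer_Q_coeff_rec(2)[OF assms(1)] A_def by simp
  ultimately have "(v\<^sup>2 + 1) * S (Suc n) = A * S n + B * v\<^sup>2 * S (n + 2)" by (simp add: algebra_simps)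
  then have "z * gegenbauer_Q l (Suc n) v = A / 2 * gegenbauer_Q l n v + B / 2 * gegenbauer_Q l (n + 2) v"
    unfolding J z_def using assms(3) by (simp add: field_simps power2_eq_square)
  then show "z * gegenbauer_Q l (Suc n) v = complex_of_real ((real n + 1) / (2 * (real n + l))) * gegenbauer_Q l n v
         + complex_of_real ((real n + 1 + 2 * l) / (2 * (real n + 2 + l))) * gegenbauer_Q l (n + 2) v"
    by (simp add: A_def B_def mult.commute)
qed

text \<open>A bound for |C_n Q_n| with (n + l) r relaxed to n + 2 l. The relaxation is chosen
  because (n + 2 l) (2 l)_n = 2 l (2 l + 1)_n, so that summability is again that of a binomial
  series.\<close>

definition gegenbauer_majorant :: "real \<Rightarrow> real \<Rightarrow> nat \<Rightarrow> real" where
  "gegenbauer_majorant l r n = 2 * gegenbauer_Q_bound l r / l * ((real n + 2 * l) * (pochhammer (2 * l) n / fact n) * r ^ n)"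

lemma summable_gegenbauer_majorant:
  assumes "l > 0" "0 \<le> r" "r < 1"
  shows "summable (gegenbauer_majorant l r)"
proof -
  have "(real n + 2 * l) * (pochhammer (2 * l) n / fact n) * r ^ n = 2 * l * (\<bar>pochhammer (2 * l + 1) n / fact n\<bar> * r ^ n)" for n
  proof -
    have "pochhammer (2 * l + 1) n \<ge> 0" using assms by (intro pochhammer_nonneg) auto
    moreover have "(real n + 2 * l) * pochhammer (2 * l) n = 2 * l * pochhammer (2 * l + 1) n"
      using pochhammer_rec[of "2 * l" n] pochhammer_Suc[of "2 * l" n] by (simp add: algebra_simps)
    ultimately show ?thesis by simp
  qed
  then show ?thesis unfolding gegenbauer_majorant_def
    by (simp only:) (intro summable_mult summable_pochhammer_fact assms)
qed

lemma gegenbauer_Q_bound_nonneg: "0 \<le> r \<Longrightarrow> r < 1 \<Longrightarrow> gegenbauer_Q_bound l r \<ge> 0"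
  unfolding gegenbauer_Q_bound_def
  by (intro suminf_nonneg summable_pochhammer_fact) (auto simp: power_less_one_iff)

text \<open>The free factor c allows both |C_n(x)| and the maximum (2 l)_n / n! itself to be
  inserted.\<close>

lemma norm_gegenbauer_Q_le_majorant:
  assumes "l > 0" "norm v \<le> r" "r < 1" "c \<le> pochhammer (2 * l) n / fact n"
  shows "c * norm (gegenbauer_Q l n v) \<le> gegenbauer_majorant l r n"
proof -
  have r: "0 \<le> r" using assms norm_ge_zero order_trans by blast
  have K: "gegenbauer_Q_bound l r \<ge> 0" using gegenbauer_Q_bound_nonneg r assms by auto
  define p where "p = pochhammer (2 * l) n / fact n"
  have p: "p \<ge> 0" unfolding p_def using assms by (auto intro!: divide_nonneg_pos pochhammer_nonneg)
  have "c * norm (gegenbauer_Q l n v) \<le> p * (2 * (real n + l) / l * r ^ (n + 1) * gegenbauer_Q_bound l r)"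
    using norm_gegenbauer_Q_le[OF assms(1-3), of n] p assms(4) by (intro mult_mono) (auto simp: p_def)
  also have "\<dots> = 2 * gegenbauer_Q_bound l r / l * p * r ^ n * ((real n + l) * r)" by simp
  also have "\<dots> \<le> 2 * gegenbauer_Q_bound l r / l * p * r ^ n * ((real n + 2 * l) * 1)"
    using assms r K p by (intro mult_left_mono mult_mono) auto
  finally show ?thesis by (simp add: gegenbauer_majorant_def p_def mult_ac)
qed

lemma Cauchy_kernel_gegenbauer_sums:
  assumes "l > 0" "norm v < 1" "v \<noteq> 0" "x \<in> {-1..1}"
  defines "z \<equiv> (v + 1 / v) / 2"
  assumes "z \<noteq> complex_of_real x"
  shows "(\<lambda>n. complex_of_real (gegenbauer l n x) * gegenbauer_Q l n v) sums (1 / (z - x))"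
proof -
  define C where "C n = complex_of_real (gegenbauer l n x)" for n
  \<comment> \<open>\<open>P\<close> and \<open>R\<close> are the boundary terms of the telescoping
    sum, of Christoffel-Darboux type: they couple C_(n+1) with Q_n and C_n with Q_(n+1).\<close>
  define P where "P n = complex_of_real ((real n + 1) / (2 * (real n + l))) * C (Suc n) * gegenbauer_Q l n v" for n
  define R where "R n = complex_of_real ((real n + 2 * l) / (2 * (real n + 1 + l))) * C n * gegenbauer_Q l (Suc n) v" for n
  define r where "r = norm v"
  have r: "0 \<le> r" "r < 1" using assms by (auto simp: r_def)
  have tel: "(z - x) * (\<Sum>n<Suc N. C n * gegenbauer_Q l n v) = 1 - P N + R N" for N
  proof (induction N)
    case 0
    have "2 * l / (2 * (1 + l)) = l / (1 + l)" using assms(1) by (simp add: divide_simps)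
    then have R0: "R 0 = complex_of_real (l / (1 + l)) * gegenbauer_Q l 1 v"
      by (simp only: R_def) (simp add: C_def)
    have P0: "P 0 = x * gegenbauer_Q l 0 v" using assms(1) by (simp add: P_def C_def)
    have "(\<Sum>n<Suc 0. C n * gegenbauer_Q l n v) = gegenbauer_Q l 0 v" by (simp add: C_def)
    then have "(z - x) * (\<Sum>n<Suc 0. C n * gegenbauer_Q l n v) = z * gegenbauer_Q l 0 v - x * gegenbauer_Q l 0 v"
      by (simp only: left_diff_distrib)
    then show ?case using gegenbauer_Q_rec(1)[OF assms(1-3)] unfolding R0 P0 z_def[symmetric] by (simp only: diff_add_eq)
  next
    case (Suc N)
    define a b c d where "a = complex_of_real ((real N + 1) / (2 * (real N + l)))"
      "b = complex_of_real ((real N + 1 + 2 * l) / (2 * (real N + 2 + l)))"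
      "c = complex_of_real ((real N + 2) / (2 * (real N + 1 + l)))"
      "d = complex_of_real ((real N + 2 * l) / (2 * (real N + 1 + l)))"
    have 1: "z * gegenbauer_Q l (Suc N) v = a * gegenbauer_Q l N v + b * gegenbauer_Q l (N + 2) v"
      using gegenbauer_Q_rec(2)[OF assms(1-3), of N] by (simp add: a_b_c_d_def flip: z_def)
    have "x * gegenbauer l (N + 1) x = (real N + 2) / (2 * (real N + 1 + l)) * gegenbauer l (N + 2) x + (real N + 2 * l) / (2 * (real N + 1 + l)) * gegenbauer l N x"
      using gegenbauer_rec[of N l x] assms(1) by (simp add: divide_simps) (simp add: algebra_simps)
    then have "complex_of_real (x * gegenbauer l (N + 1) x) = complex_of_real ((real N + 2) / (2 * (real N + 1 + l)) * gegenbauer l (N + 2) x + (real N + 2 * l) / (2 * (real N + 1 + l)) * gegenbauer l N x)"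
      by (rule arg_cong)
    then have 2: "x * C (Suc N) = c * C (N + 2) + d * C N"
      unfolding C_def a_b_c_d_def by (simp only: of_real_mult of_real_add Suc_eq_plus1)
    have PR: "P N = a * C (Suc N) * gegenbauer_Q l N v" "R N = d * C N * gegenbauer_Q l (Suc N) v"
      "P (Suc N) = c * C (N + 2) * gegenbauer_Q l (Suc N) v" "R (Suc N) = b * C (Suc N) * gegenbauer_Q l (N + 2) v"
      by (simp_all add: P_def R_def a_b_c_d_def add_ac)
    have "(z - x) * (\<Sum>n<Suc (Suc N). C n * gegenbauer_Q l n v) = (1 - P N + R N) + (z - x) * (C (Suc N) * gegenbauer_Q l (Suc N) v)"
      unfolding Suc[symmetric] sum.lessThan_Suc[of _ "Suc N"] by (simp only: distrib_left)
    \<comment> \<open>Applying one recurrence to z Q_(N+1) and the other to x C_(N+1) turns the new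
      summand into P N - P (N + 1) + R (N + 1) - R N.\<close>
    also have "\<dots> = 1 - P (Suc N) + R (Suc N)"
      unfolding PR using 1 2 by algebra
    finally show ?case .
  qed
  have M0: "gegenbauer_majorant l r \<longlonglongrightarrow> 0"
    by (rule summable_LIMSEQ_zero[OF summable_gegenbauer_majorant[OF assms(1) r]])
  have K: "gegenbauer_Q_bound l r \<ge> 0" using gegenbauer_Q_bound_nonneg r by auto
  have C: "norm (C n) \<le> pochhammer (2 * l) n / fact n" for n
    using abs_gegenbauer_le[OF assms(1,4)] by (simp add: C_def)
  have J: "norm (gegenbauer_Q l n v) \<le> 2 * (real n + l) / l * r ^ (n + 1) * gegenbauer_Q_bound l r" for n
    by (rule norm_gegenbauer_Q_le) (use assms in \<open>auto simp: r_def\<close>)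
  have pn: "pochhammer (2 * l) n / fact n \<ge> 0" for n
    using assms by (auto intro!: divide_nonneg_pos pochhammer_nonneg)
  \<comment> \<open>The index is shifted because \<open>P n\<close> contains C_(n+1) and r^(n + 1),
    the ingredients of the majorant at n + 1.\<close>
  have Pb: "norm (P n) \<le> gegenbauer_majorant l r (Suc n)" for n
  proof -
    have "norm (P n) = (real n + 1) / (2 * (real n + l)) * (norm (C (Suc n)) * norm (gegenbauer_Q l n v))"
      unfolding P_def norm_mult norm_of_real using assms(1) by (simp add: abs_of_nonneg)
    also have "\<dots> \<le> (real n + 1) / (2 * (real n + l)) * ((pochhammer (2 * l) (Suc n) / fact (Suc n)) * (2 * (real n + l) / l * r ^ (n + 1) * gegenbauer_Q_bound l r))"
      using C[of "Suc n"] J[of n] assms(1) pn[of "Suc n"] by (intro mult_left_mono mult_mono) auto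
    also have "\<dots> = gegenbauer_Q_bound l r / l * (pochhammer (2 * l) (Suc n) / fact (Suc n)) * r ^ (n + 1) * (real n + 1)"
      using assms(1) by (simp add: divide_simps del: fact_Suc)
    also have "\<dots> \<le> gegenbauer_Q_bound l r / l * (pochhammer (2 * l) (Suc n) / fact (Suc n)) * r ^ (n + 1) * (2 * (real (Suc n) + 2 * l))"
      using assms(1) K pn[of "Suc n"] r by (intro mult_left_mono mult_nonneg_nonneg) auto
    also have "\<dots> = gegenbauer_majorant l r (Suc n)" by (simp add: gegenbauer_majorant_def mult_ac del: fact_Suc)
    finally show ?thesis .
  qed
  have Rb: "norm (R n) \<le> gegenbauer_majorant l r n" for n
  proof -
    have "norm (R n) = (real n + 2 * l) / (2 * (real n + 1 + l)) * (norm (C n) * norm (gegenbauer_Q l (Suc n) v))"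
      unfolding R_def norm_mult norm_of_real using assms(1) by (simp add: abs_of_nonneg)
    also have "\<dots> \<le> (real n + 2 * l) / (2 * (real n + 1 + l)) * ((pochhammer (2 * l) n / fact n) * (2 * (real (Suc n) + l) / l * r ^ (Suc n + 1) * gegenbauer_Q_bound l r))"
      using C[of n] J[of "Suc n"] assms(1) pn[of n] by (intro mult_left_mono mult_mono) auto
    also have "\<dots> = (real n + 2 * l) * gegenbauer_Q_bound l r / l * (pochhammer (2 * l) n / fact n) * r ^ (n + 2)"
      using assms(1) by (simp add: divide_simps del: power_Suc) 
    also have "\<dots> \<le> (real n + 2 * l) * gegenbauer_Q_bound l r / l * (pochhammer (2 * l) n / fact n) * (2 * r ^ n)"
    proof (intro mult_left_mono mult_nonneg_nonneg)
      have "r ^ (n + 2) \<le> r ^ n" using r by (intro power_decreasing) auto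
      then show "r ^ (n + 2) \<le> 2 * r ^ n" using r zero_le_power[of r n] by linarith
    qed (use assms(1) K pn[of n] in auto)
    also have "\<dots> = gegenbauer_majorant l r n" by (simp add: gegenbauer_majorant_def mult_ac)
    finally show ?thesis .
  qed
  have "P \<longlonglongrightarrow> 0" by (rule Lim_null_comparison[OF _ LIMSEQ_Suc[OF M0]]) (use Pb in auto)
  moreover have "R \<longlonglongrightarrow> 0" by (rule Lim_null_comparison[OF _ M0]) (use Rb in auto)
  ultimately have "(\<lambda>N. (1 - P N + R N) / (z - x)) \<longlonglongrightarrow> (1 - 0 + 0) / (z - x)"
    using assms(6) by (intro tendsto_intros) auto
  then have "(\<lambda>N. \<Sum>n<Suc N. C n * gegenbauer_Q l n v) \<longlonglongrightarrow> 1 / (z - x)"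
    unfolding tel[symmetric] using assms(6) by simp
  then show ?thesis unfolding sums_def C_def by (subst (asm) filterlim_sequentially_Suc)
qed

section \<open>Hypergeometric form and extremal bounds\<close>

definition gauss_coeff :: "real \<Rightarrow> nat \<Rightarrow> nat \<Rightarrow> real" where
  "gauss_coeff l n k = pochhammer (real n + 1) k * pochhammer (1 - l) k / (pochhammer (real n + l + 1) k * fact k)"

lemma gegenbauer_Q_coeff_eq_gauss_coeff:
  assumes "l > 0"
  shows "gegenbauer_Q_coeff l n k = 2 * fact n / pochhammer l n * gauss_coeff l n k"
proof -
  have f: "fact (n + k) = (fact n * pochhammer (real n + 1) k :: real)"
    unfolding pochhammer_fact pochhammer_product' by (simp add: add.commute)
  have p: "pochhammer l (n + k + 1) = pochhammer l n * ((real n + l) * pochhammer (real n + l + 1) k)"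
    using pochhammer_product'[of l n "Suc k"] pochhammer_rec[of "l + real n" k] by (simp add: add_ac)
  have "real n + l \<noteq> 0" using assms by simp
  then show ?thesis unfolding gegenbauer_Q_coeff_def gauss_coeff_def f p by (simp add: mult_ac)
qed

lemma gegenbauer_Q_eq_gauss:
  assumes "l > 0" "norm v < 1"
  shows "(\<lambda>k. complex_of_real (gauss_coeff l n k) * (v\<^sup>2) ^ k) sums
           (\<Sum>k. complex_of_real (gauss_coeff l n k) * (v\<^sup>2) ^ k)"
    and "gegenbauer_Q l n v = complex_of_real (2 * fact n / pochhammer l n) * v ^ (n + 1)
           * (\<Sum>k. complex_of_real (gauss_coeff l n k) * (v\<^sup>2) ^ k)"
proof -
  define c where "c = complex_of_real (2 * fact n / pochhammer l n)"
  have c: "c \<noteq> 0" using pochhammer_pos[OF assms(1), of n] by (simp add: c_def)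
  have e: "complex_of_real (gegenbauer_Q_coeff l n k) * (v\<^sup>2) ^ k = c * (complex_of_real (gauss_coeff l n k) * (v\<^sup>2) ^ k)" for k
    unfolding gegenbauer_Q_coeff_eq_gauss_coeff[OF assms(1)] c_def by (simp only: of_real_mult mult.assoc)
  note s = sums_gegenbauer_Q_series[OF assms, of n, unfolded e]
  have "(\<lambda>k. inverse c * (c * (complex_of_real (gauss_coeff l n k) * (v\<^sup>2) ^ k))) sums
      (inverse c * (\<Sum>k. c * (complex_of_real (gauss_coeff l n k) * (v\<^sup>2) ^ k)))"
    by (rule sums_mult[OF s])
  then have s': "summable (\<lambda>k. complex_of_real (gauss_coeff l n k) * (v\<^sup>2) ^ k)"
    using c by (auto simp: sums_iff simp flip: mult.assoc)
  then show "(\<lambda>k. complex_of_real (gauss_coeff l n k) * (v\<^sup>2) ^ k) sums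
           (\<Sum>k. complex_of_real (gauss_coeff l n k) * (v\<^sup>2) ^ k)" by (rule summable_sums)
  show "gegenbauer_Q l n v = c * v ^ (n + 1) * (\<Sum>k. complex_of_real (gauss_coeff l n k) * (v\<^sup>2) ^ k)"
    unfolding gegenbauer_Q_def e suminf_mult[OF s'] by (simp only: mult_ac)
qed

text \<open>Only v^2 has to be real, so the lemma covers both real and purely imaginary v, the two
  kinds of extremal point.\<close>

lemma gauss_sum_of_real:
  assumes "l > 0" "norm v < 1" "v\<^sup>2 = complex_of_real y"
  shows "(\<Sum>k. complex_of_real (gauss_coeff l n k) * (v\<^sup>2) ^ k) =
     complex_of_real (hyp2F1 (real n + 1) (1 - l) (real n + l + 1) y)"
proof -
  have "(\<lambda>k. complex_of_real (gauss_coeff l n k * y ^ k)) sums (\<Sum>k. complex_of_real (gauss_coeff l n k) * (v\<^sup>2) ^ k)"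
    using gegenbauer_Q_eq_gauss(1)[OF assms(1,2), of n] by (simp add: assms(3))
  then have "summable (\<lambda>k. complex_of_real (gauss_coeff l n k * y ^ k))" by (rule sums_summable)
  then have "summable (\<lambda>k. gauss_coeff l n k * y ^ k)" by (simp only: summable_of_real_iff)
  then have "(\<lambda>k. gauss_coeff l n k * y ^ k) sums hyp2F1 (real n + 1) (1 - l) (real n + l + 1) y"
    unfolding hyp2F1_def gauss_coeff_def by (rule summable_sums)
  then have "(\<lambda>k. complex_of_real (gauss_coeff l n k * y ^ k)) sums complex_of_real (hyp2F1 (real n + 1) (1 - l) (real n + l + 1) y)"
    by (rule sums_of_real)
  then show ?thesis
    using gegenbauer_Q_eq_gauss(1)[OF assms(1,2), of n] sums_unique2 by (simp add: assms(3)) blast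
qed

lemma norm_gauss_sum_le_of_le_1:
  assumes "l > 0" "l \<le> 1" "norm v < 1"
  shows "norm (\<Sum>k. complex_of_real (gauss_coeff l n k) * (v\<^sup>2) ^ k) \<le>
     hyp2F1 (real n + 1) (1 - l) (real n + l + 1) ((norm v)\<^sup>2)"
proof -
  have nn: "gauss_coeff l n k \<ge> 0" for k
  proof -
    \<comment> \<open>At l = 1 the base is 0 rather than positive, and the symbol is 1 for k = 0 and
      0 afterwards.\<close>
    have "pochhammer (1 - l) k \<ge> 0"
      using assms by (cases "l = 1") (auto intro!: pochhammer_nonneg simp: pochhammer_0_left)
    then show ?thesis using assms unfolding gauss_coeff_def
      by (intro divide_nonneg_pos mult_nonneg_nonneg mult_pos_pos pochhammer_pos)
         (auto intro!: pochhammer_nonneg)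
  qed
  have e: "norm (complex_of_real (gauss_coeff l n k) * (v\<^sup>2) ^ k) = gauss_coeff l n k * ((norm v)\<^sup>2) ^ k" for k
    using nn by (simp add: norm_mult norm_power)
  have "(\<lambda>k. complex_of_real (gauss_coeff l n k) * ((complex_of_real (norm v))\<^sup>2) ^ k) sums
     (\<Sum>k. complex_of_real (gauss_coeff l n k) * ((complex_of_real (norm v))\<^sup>2) ^ k)"
    by (rule gegenbauer_Q_eq_gauss(1)) (use assms in auto)
  then have "summable (\<lambda>k. complex_of_real (gauss_coeff l n k * ((norm v)\<^sup>2) ^ k))"
    by (simp add: sums_iff)
  then have s: "summable (\<lambda>k. gauss_coeff l n k * ((norm v)\<^sup>2) ^ k)" by (simp only: summable_of_real_iff)
  have "norm (\<Sum>k. complex_of_real (gauss_coeff l n k) * (v\<^sup>2) ^ k) \<le> (\<Sum>k. gauss_coeff l n k * ((norm v)\<^sup>2) ^ k)"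
    unfolding e[symmetric] by (rule summable_norm) (simp only: e s)
  then show ?thesis by (simp add: hyp2F1_def gauss_coeff_def)
qed

section \<open>Euler's integral and the maximum for parameters at least 1\<close>

lemma Gamma_add_nat:
  assumes "(a::real) > 0"
  shows "Gamma (a + real k) = pochhammer a k * Gamma a"
proof -
  have "a \<notin> \<int>\<^sub>\<le>\<^sub>0" using assms by (auto elim!: nonpos_Ints_cases)
  then show ?thesis using pochhammer_Gamma[of a k] Gamma_pos_neq_0[OF assms] by simp
qed

text \<open>The left side is the k-th moment of the Beta weight; the quotient on the right is what
  distinguishes \<open>gauss_coeff\<close> from a binomial coefficient, so integration supplies it
  termwise.\<close>

lemma Beta_pochhammer:
  assumes "l > 0"
  shows "Beta (real n + 1 + real k) l = Beta (real n + 1) l * (pochhammer (real n + 1) k / pochhammer (real n + l + 1) k)"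
proof -
  have "Gamma (real n + 1 + real k) = pochhammer (real n + 1) k * Gamma (real n + 1)"
    "Gamma (real n + l + 1 + real k) = pochhammer (real n + l + 1) k * Gamma (real n + l + 1)"
    using assms by (simp_all add: Gamma_add_nat)
  then show ?thesis unfolding Beta_def by (simp add: add_ac mult_ac)
qed

text \<open>Euler's integral for the hypergeometric series; at t = 0 the convention 0 powr 0 = 0 is harmless.\<close>

lemma has_integral_euler:
  fixes n :: nat and l :: real and y S :: complex
  assumes "l > 0" "norm y < 1"
  defines "\<omega> \<equiv> (\<lambda>t::real. t powr (real n + 1 - 1) * (1 - t) powr (l - 1))"
  assumes s: "(\<lambda>k. complex_of_real (gauss_coeff l n k) * y ^ k) sums S"
  shows "((\<lambda>t::real. complex_of_real (\<omega> t) * (1 - t * y) powr (complex_of_real (l - 1))) has_integral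
     (complex_of_real (Beta (real n + 1) l) * S)) {0..1}"
proof -
  define c where "c k = pochhammer (1 - l) k / fact k" for k
  define A where "A = (\<Sum>k. \<bar>c k\<bar> * norm y ^ k)"
  have sA: "summable (\<lambda>k. \<bar>c k\<bar> * norm y ^ k)"
    unfolding c_def by (rule summable_pochhammer_fact) (use assms in auto)
  have \<omega>int: "(\<omega> has_integral Beta (real n + 1) l) {0..1}"
    unfolding \<omega>_def using assms by (intro has_integral_Beta_real) auto
  have \<omega>0: "\<omega> t \<ge> 0" for t by (simp add: \<omega>_def)
  have trm: "((\<lambda>t::real. complex_of_real (\<omega> t) * (complex_of_real (c k) * (t * y) ^ k)) has_integral
     complex_of_real (Beta (real n + 1) l) * (complex_of_real (gauss_coeff l n k) * y ^ k)) {0..1}" for k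
  proof -
    have "((\<lambda>t. t powr (real n + 1 + real k - 1) * (1 - t) powr (l - 1)) has_integral Beta (real n + 1 + real k) l) {0..1}"
      using assms by (intro has_integral_Beta_real) auto
    then have "((\<lambda>t. \<omega> t * t ^ k) has_integral Beta (real n + 1 + real k) l) {0..1}"
    proof (rule has_integral_eq[rotated])
      fix t :: real assume "t \<in> {0..1}"
      then have "t powr (real n + 1 + real k - 1) = t powr (real n + 1 - 1) * t ^ k"
        by (cases "t = 0") (auto simp: powr_add powr_realpow)
      then show "t powr (real n + 1 + real k - 1) * (1 - t) powr (l - 1) = \<omega> t * t ^ k"
        by (simp add: \<omega>_def)
    qed
    then have "((\<lambda>t. complex_of_real (\<omega> t * t ^ k)) has_integral complex_of_real (Beta (real n + 1 + real k) l)) {0..1}"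
      by (rule has_integral_of_real)
    from has_integral_mult_right[OF this, of "complex_of_real (c k) * y ^ k"] show ?thesis
      unfolding Beta_pochhammer[OF assms(1)] gauss_coeff_def c_def
      by (simp add: power_mult_distrib mult_ac)
  qed
  define F where "F N t = (\<Sum>k<N. complex_of_real (\<omega> t) * (complex_of_real (c k) * (t * y) ^ k))" for N and t :: real
  show ?thesis
  \<comment> \<open>The partial sums of the binomial series at t y are dominated by the absolutely
    convergent series at |y|, uniformly in t, leaving an integrable multiple of the Beta
    weight.\<close>
  proof (rule has_integral_dominated_convergence[of F "\<lambda>N. \<Sum>k<N. complex_of_real (Beta (real n + 1) l) * (complex_of_real (gauss_coeff l n k) * y ^ k)" _ "\<lambda>t. \<omega> t * A"])
    show "(F N has_integral (\<Sum>k<N. complex_of_real (Beta (real n + 1) l) * (complex_of_real (gauss_coeff l n k) * y ^ k))) {0..1}" for N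
      unfolding F_def by (intro has_integral_sum trm) auto
    show "(\<lambda>t. \<omega> t * A) integrable_on {0..1}"
      using has_integral_mult_left[OF \<omega>int] by (auto simp: integrable_on_def)
    show "\<forall>t\<in>{0..1}. norm (F N t) \<le> \<omega> t * A" for N
    proof
      fix t :: real assume t: "t \<in> {0..1}"
      have "norm (\<Sum>k<N. complex_of_real (c k) * (t * y) ^ k) \<le> (\<Sum>k<N. \<bar>c k\<bar> * norm y ^ k)"
      proof (rule sum_norm_le)
        fix k
        have "norm (complex_of_real t * y) \<le> norm y" using t by (simp add: norm_mult mult_left_le_one_le)
        then show "norm (complex_of_real (c k) * (t * y) ^ k) \<le> \<bar>c k\<bar> * norm y ^ k"
          by (simp add: norm_mult[of "of_real (c k)"] norm_power mult_left_mono power_mono)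
      qed
      also have "\<dots> \<le> A" unfolding A_def by (rule sum_le_suminf[OF sA]) auto
      finally show "norm (F N t) \<le> \<omega> t * A"
        unfolding F_def sum_distrib_left[symmetric] using \<omega>0[of t] by (simp add: norm_mult mult_left_mono)
    qed
    show "\<forall>t\<in>{0..1}. (\<lambda>N. F N t) \<longlonglongrightarrow> complex_of_real (\<omega> t) * (1 - t * y) powr (complex_of_real (l - 1))"
    proof
      fix t :: real assume t: "t \<in> {0..1}"
      have "norm (complex_of_real t * y) \<le> norm y" using t by (simp add: norm_mult mult_left_le_one_le)
      then have "norm (- (complex_of_real t * y)) < 1" using assms by simp
      from gen_binomial_complex[OF this, of "complex_of_real (l - 1)"]
      have "(\<lambda>k. (complex_of_real (l - 1) gchoose k) * (- (t * y)) ^ k) sums (1 - t * y) powr complex_of_real (l - 1)"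
        by simp
      moreover have "(complex_of_real (l - 1) gchoose k) * (- (t * y)) ^ k = complex_of_real (c k) * (t * y) ^ k" for k
      proof -
        \<comment> \<open>The sign relating binomial coefficients to Pochhammer symbols cancels
          against that of (- t y)^k.\<close>
        have "(complex_of_real (l - 1) gchoose k) = (-1) ^ k * complex_of_real (c k)"
          unfolding gbinomial_pochhammer c_def of_real_divide
          by (simp flip: pochhammer_of_real)
        moreover have "(- (t * y)) ^ k = (-1) ^ k * (t * y) ^ k" by (rule power_minus)
        ultimately show ?thesis by (simp add: mult_ac flip: power_mult_distrib)
      qed
      ultimately have "(\<lambda>k. complex_of_real (c k) * (t * y) ^ k) sums (1 - t * y) powr complex_of_real (l - 1)"
        by simp
      from sums_mult[OF this, of "complex_of_real (\<omega> t)"]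
      show "(\<lambda>N. F N t) \<longlonglongrightarrow> complex_of_real (\<omega> t) * (1 - t * y) powr (complex_of_real (l - 1))"
        by (simp add: F_def sums_def)
    qed
    show "(\<lambda>N. \<Sum>k<N. complex_of_real (Beta (real n + 1) l) * (complex_of_real (gauss_coeff l n k) * y ^ k)) \<longlonglongrightarrow> complex_of_real (Beta (real n + 1) l) * S"
      using sums_mult[OF s] by (simp add: sums_def)
  qed
qed

text \<open>The exponent l - 1 is nonnegative, so |1 - t v^2| \<le> 1 + t |v|^2 survives the power.
  At negative v^2 the bound is an equality for every t, and the right side is Euler's integral at
  that point.\<close>

lemma norm_gauss_sum_le_of_ge_1:
  assumes "l \<ge> 1" "norm v < 1"
  shows "norm (\<Sum>k. complex_of_real (gauss_coeff l n k) * (v\<^sup>2) ^ k) \<le>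
     hyp2F1 (real n + 1) (1 - l) (real n + l + 1) (- ((norm v)\<^sup>2))"
proof -
  define S where "S = (\<Sum>k. complex_of_real (gauss_coeff l n k) * (v\<^sup>2) ^ k)"
  define H where "H = hyp2F1 (real n + 1) (1 - l) (real n + l + 1) (- ((norm v)\<^sup>2))"
  define r where "r = norm v"
  define y where "y = complex_of_real (- r\<^sup>2)"
  define \<omega> where "\<omega> = (\<lambda>t::real. t powr (real n + 1 - 1) * (1 - t) powr (l - 1))"
  define B where "B = Beta (real n + 1) l"
  have l: "l > 0" using assms by simp
  have r: "0 \<le> r" "r < 1" "r\<^sup>2 < 1" using assms by (auto simp: r_def power_less_one_iff)
  have B: "B > 0" unfolding B_def Beta_def using l
    by (intro divide_pos_pos mult_pos_pos Gamma_real_pos) auto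
  have y: "(\<i> * complex_of_real r)\<^sup>2 = y" by (simp add: y_def power_mult_distrib)
  have nir: "norm (\<i> * complex_of_real r) < 1" using r by (simp add: norm_mult)
  have "(\<Sum>k. complex_of_real (gauss_coeff l n k) * ((\<i> * complex_of_real r)\<^sup>2) ^ k) = complex_of_real H"
    unfolding H_def r_def[symmetric]
    by (rule gauss_sum_of_real[OF l nir]) (simp add: y y_def)
  with gegenbauer_Q_eq_gauss(1)[OF l nir, of n]
  have sH: "(\<lambda>k. complex_of_real (gauss_coeff l n k) * y ^ k) sums complex_of_real H" by (simp add: y)
  have ny: "norm y < 1" "norm (v\<^sup>2) < 1" using r by (simp_all add: y_def norm_power flip: r_def)
  have I1: "((\<lambda>t::real. complex_of_real (\<omega> t) * (1 - t * v\<^sup>2) powr (complex_of_real (l - 1))) has_integral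
     (complex_of_real B * S)) {0..1}"
    unfolding \<omega>_def B_def S_def by (rule has_integral_euler[OF l ny(2) gegenbauer_Q_eq_gauss(1)[OF l assms(2)]])
  have "((\<lambda>t::real. complex_of_real (\<omega> t) * (1 - t * y) powr (complex_of_real (l - 1))) has_integral
     (complex_of_real B * complex_of_real H)) {0..1}"
    unfolding \<omega>_def B_def by (rule has_integral_euler[OF l ny(1) sH])
  \<comment> \<open>At the real point y the integrand is real but typed complex; its real part
    serves as the dominating function.\<close>
  note I2 = has_integral_linear[OF this bounded_linear_Re]
  have "norm (integral {0..1} (\<lambda>t::real. complex_of_real (\<omega> t) * (1 - t * v\<^sup>2) powr (complex_of_real (l - 1))))
    \<le> integral {0..1} (Re \<circ> (\<lambda>t::real. complex_of_real (\<omega> t) * (1 - t * y) powr (complex_of_real (l - 1))))"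
  proof (rule integral_norm_bound_integral)
    show "(\<lambda>t::real. complex_of_real (\<omega> t) * (1 - t * v\<^sup>2) powr (complex_of_real (l - 1))) integrable_on {0..1}"
      using I1 by (auto simp: integrable_on_def)
    show "(Re \<circ> (\<lambda>t::real. complex_of_real (\<omega> t) * (1 - t * y) powr (complex_of_real (l - 1)))) integrable_on {0..1}"
      using I2 by (auto simp: integrable_on_def)
    fix t :: real assume t: "t \<in> {0..1}"
    have pos: "0 < 1 + t * r\<^sup>2" using t by (simp add: add_pos_nonneg)
    have e: "1 - t * y = complex_of_real (1 + t * r\<^sup>2)" by (simp add: y_def)
    have "norm ((1 - t * v\<^sup>2) powr complex_of_real (l - 1)) = norm (1 - t * v\<^sup>2) powr (l - 1)"
      by (cases "1 - t * v\<^sup>2 = 0") (simp_all add: norm_powr_real_powr')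
    also have "\<dots> \<le> (1 + t * r\<^sup>2) powr (l - 1)"
    proof (rule powr_mono2)
      have "norm (1 - t * v\<^sup>2) \<le> norm (1::complex) + norm (t * v\<^sup>2)" by (rule norm_triangle_ineq4)
      then show "norm (1 - t * v\<^sup>2) \<le> 1 + t * r\<^sup>2" using t by (simp add: norm_mult norm_power r_def)
    qed (use assms in auto)
    also have "\<dots> = Re ((1 - t * y) powr complex_of_real (l - 1))"
      unfolding e using pos by (subst powr_of_real) auto
    finally have "norm ((1 - t * v\<^sup>2) powr complex_of_real (l - 1)) \<le> Re ((1 - t * y) powr complex_of_real (l - 1))" .
    moreover have "\<omega> t \<ge> 0" by (simp add: \<omega>_def)
    ultimately show "norm (complex_of_real (\<omega> t) * (1 - t * v\<^sup>2) powr (complex_of_real (l - 1))) \<le>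
       (Re \<circ> (\<lambda>t::real. complex_of_real (\<omega> t) * (1 - t * y) powr (complex_of_real (l - 1)))) t"
      by (simp add: norm_mult mult_left_mono)
  qed
  then have "norm (complex_of_real B * S) \<le> Re (complex_of_real B * complex_of_real H)"
    unfolding integral_unique[OF I1] integral_unique[OF I2] .
  then have "B * norm S \<le> B * H" using B by (simp add: norm_mult)
  then show ?thesis using B by (simp add: S_def H_def)
qed

section \<open>The Bernstein ellipse\<close>

definition bernstein_path' :: "real \<Rightarrow> real \<Rightarrow> complex" where
  "bernstein_path' \<rho> \<theta> = \<i> * (complex_of_real \<rho> * exp (\<i> * complex_of_real \<theta>)
      - complex_of_real (inverse \<rho>) * exp (- \<i> * complex_of_real \<theta>)) / 2"

lemma bernstein_path_has_vector_derivative: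
  "(bernstein_path \<rho> has_vector_derivative bernstein_path' \<rho> \<theta>) (at \<theta> within A)"
  unfolding bernstein_path_def[abs_def] bernstein_path'_def
  by (rule has_vector_derivative_real_field) (auto intro!: derivative_eq_intros simp: algebra_simps add_divide_distrib diff_divide_distrib)

lemma continuous_on_bernstein_path: "continuous_on A (bernstein_path \<rho>)"
  unfolding bernstein_path_def by (intro continuous_intros) auto

lemma continuous_on_bernstein_path': "continuous_on A (bernstein_path' \<rho>)"
  unfolding bernstein_path'_def by (intro continuous_intros) auto

text \<open>With u = \<rho> exp(i \<theta>), the point minus or plus 1 is (u - 1)^2 / (2 u) or (u +
  1)^2 / (2 u), and the parallelogram law adds the two moduli. This links the parametrised curve to
  the focal description of the region.\<close>

lemma bernstein_path_focal_sum:
  assumes "\<rho> > 0"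
  shows "cmod (bernstein_path \<rho> \<theta> - 1) + cmod (bernstein_path \<rho> \<theta> + 1) = \<rho> + inverse \<rho>"
proof -
  define u where "u = complex_of_real \<rho> * exp (\<i> * complex_of_real \<theta>)"
  have u: "cmod u = \<rho>" "u \<noteq> 0" using assms by (auto simp: u_def norm_mult)
  have p: "bernstein_path \<rho> \<theta> = (u + 1 / u) / 2"
    unfolding bernstein_path_def u_def by (simp add: exp_minus field_simps)
  have "bernstein_path \<rho> \<theta> - 1 = (u - 1)\<^sup>2 / (2 * u)" "bernstein_path \<rho> \<theta> + 1 = (u + 1)\<^sup>2 / (2 * u)"
    unfolding p using u(2) by (simp_all add: field_simps power2_eq_square)
  then have "cmod (bernstein_path \<rho> \<theta> - 1) + cmod (bernstein_path \<rho> \<theta> + 1) = ((cmod (u - 1))\<^sup>2 + (cmod (u + 1))\<^sup>2) / (2 * \<rho>)"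
    using u by (simp add: norm_divide norm_mult norm_power add_divide_distrib)
  also have "(cmod (u - 1))\<^sup>2 + (cmod (u + 1))\<^sup>2 = 2 * (cmod u)\<^sup>2 + 2"
    unfolding cmod_power2 by (simp add: power2_eq_square algebra_simps)
  finally show ?thesis using assms u by (simp add: field_simps power2_eq_square)
qed

lemma inverse_add_gt_2:
  assumes "\<rho> > (1::real)"
  shows "\<rho> + inverse \<rho> > 2"
proof -
  have "0 < (\<rho> - 1)\<^sup>2 / \<rho>" using assms by simp
  also have "(\<rho> - 1)\<^sup>2 / \<rho> = \<rho> + inverse \<rho> - 2" using assms by (simp add: field_simps power2_eq_square)
  finally show ?thesis by simp
qed

text \<open>The interval is the degenerate ellipse with focal sum 2, strictly below \<rho> +
  1/\<rho>; this keeps it off the contour and inside the region.\<close>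

lemma cmod_real_focal_sum:
  assumes "x \<in> {-1..1}"
  shows "cmod (complex_of_real x - 1) + cmod (complex_of_real x + 1) = 2"
proof -
  have "complex_of_real x - 1 = complex_of_real (x - 1)" "complex_of_real x + 1 = complex_of_real (x + 1)" by auto
  then show ?thesis using assms by (simp only: norm_of_real) auto
qed

lemma bernstein_path_neq_real:
  assumes "\<rho> > 1" "x \<in> {-1..1}"
  shows "bernstein_path \<rho> \<theta> \<noteq> complex_of_real x"
  using bernstein_path_focal_sum[of \<rho> \<theta>] cmod_real_focal_sum[OF assms(2)] inverse_add_gt_2[OF assms(1)] assms
  by auto

text \<open>The focal sum is a convex function and the region one of its sublevel sets; convexity
  gives access to Cauchy's formula without further topology.\<close>

lemma convex_bernstein_region: "convex (bernstein_region \<rho>)"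
proof (rule convexI)
  fix a b :: complex and s t :: real
  assume a: "a \<in> bernstein_region \<rho>" and b: "b \<in> bernstein_region \<rho>" and st: "0 \<le> s" "0 \<le> t" "s + t = 1"
  have e: "cmod (s *\<^sub>R a + t *\<^sub>R b - c) \<le> s * cmod (a - c) + t * cmod (b - c)" for c
  proof -
    have "s *\<^sub>R a + t *\<^sub>R b - (s + t) *\<^sub>R c = s *\<^sub>R (a - c) + t *\<^sub>R (b - c)" by (simp add: algebra_simps)
    then have "s *\<^sub>R a + t *\<^sub>R b - c = s *\<^sub>R (a - c) + t *\<^sub>R (b - c)" using st(3) by simp
    then show ?thesis using norm_triangle_ineq[of "s *\<^sub>R (a - c)" "t *\<^sub>R (b - c)"] st by simp
  qed
  have "cmod (s *\<^sub>R a + t *\<^sub>R b - 1) + cmod (s *\<^sub>R a + t *\<^sub>R b + 1) \<le>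
      s * (cmod (a - 1) + cmod (a + 1)) + t * (cmod (b - 1) + cmod (b + 1))"
    using e[of 1] e[of "-1"] by (simp add: algebra_simps)
  also have "\<dots> \<le> s * (\<rho> + inverse \<rho>) + t * (\<rho> + inverse \<rho>)"
    using a b st by (intro add_mono[OF mult_left_mono mult_left_mono]) (auto simp: bernstein_region_def)
  also have "\<dots> = \<rho> + inverse \<rho>" using st(3) by (metis distrib_right mult_1)
  finally show "s *\<^sub>R a + t *\<^sub>R b \<in> bernstein_region \<rho>" by (simp add: bernstein_region_def)
qed

lemma real_in_interior_bernstein_region:
  assumes "\<rho> > 1" "x \<in> {-1..1}"
  shows "complex_of_real x \<in> interior (bernstein_region \<rho>)"
proof (rule interiorI)
  show "open {z. cmod (z - 1) + cmod (z + 1) < \<rho> + inverse \<rho>}"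
    by (intro open_Collect_less continuous_intros)
  show "complex_of_real x \<in> {z. cmod (z - 1) + cmod (z + 1) < \<rho> + inverse \<rho>}"
    using cmod_real_focal_sum[OF assms(2)] inverse_add_gt_2[OF assms(1)] by simp
qed (auto simp: bernstein_region_def)

text \<open>The same curve rescaled to [0,1], the parameter interval of contour integrals.\<close>

definition ellipse_curve :: "real \<Rightarrow> real \<Rightarrow> complex" where
  "ellipse_curve \<rho> t = bernstein_path \<rho> (2 * pi * t)"

lemma ellipse_curve_has_vector_derivative:
  "(ellipse_curve \<rho> has_vector_derivative (2 * pi * bernstein_path' \<rho> (2 * pi * t))) (at t within A)"
proof -
  have "((\<lambda>t. 2 * pi * t) has_vector_derivative 2 * pi) (at t within A)"
    by (auto intro!: derivative_eq_intros simp: has_vector_derivative_def mult.commute)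
  from vector_diff_chain_within[OF this bernstein_path_has_vector_derivative]
  show ?thesis by (simp add: ellipse_curve_def[abs_def] o_def scaleR_conv_of_real)
qed

lemma vector_derivative_ellipse_curve:
  "vector_derivative (ellipse_curve \<rho>) (at t) = 2 * pi * bernstein_path' \<rho> (2 * pi * t)"
  by (rule vector_derivative_at[OF ellipse_curve_has_vector_derivative])

lemma valid_path_ellipse_curve: "valid_path (ellipse_curve \<rho>)"
proof (rule C1_differentiable_imp_piecewise[of _ "{0..1}", folded valid_path_def])
  show "ellipse_curve \<rho> C1_differentiable_on {0..1}"
    unfolding C1_differentiable_on_def
  proof (intro exI conjI ballI)
    show "(ellipse_curve \<rho> has_vector_derivative (2 * pi * bernstein_path' \<rho> (2 * pi * t))) (at t)" for t
      by (rule ellipse_curve_has_vector_derivative)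
    show "continuous_on {0..1} (\<lambda>t. complex_of_real (2 * pi) * bernstein_path' \<rho> (2 * pi * t))"
      by (intro continuous_intros continuous_on_compose2[OF continuous_on_bernstein_path'[of UNIV]]) auto
  qed
qed

text \<open>Pulled back along z = (u + 1/u)/2, the form dz / (z - x) becomes du / (u - a) + du / (u
  - cnj a) - du / u, where a = exp(i arccos x). All three poles lie inside |u| = \<rho>, so the
  winding number is 1 + 1 - 1.\<close>

lemma winding_number_ellipse_curve:
  assumes "\<rho> > 1" "x \<in> {-1..1}"
  shows "winding_number (ellipse_curve \<rho>) (complex_of_real x) = 1"
proof -
  define a where "a = cis (arccos x)"
  have a: "cmod a = 1" "cmod (cnj a) = 1" "a * cnj a = 1" "a + cnj a = 2 * complex_of_real x"
    using assms(2) by (auto simp: a_def cis_cnj cis_mult complex_eq_iff cos_arccos)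
  define U where "U t = circlepath 0 \<rho> t" for t
  have cauchy: "((\<lambda>w. 1 / (w - c)) has_contour_integral (2 * pi * \<i>)) (circlepath 0 \<rho>)" if "cmod c \<le> 1" for c
    using Cauchy_integral_circlepath_simple[of "\<lambda>_. 1" 0 \<rho> c] that assms by simp
  have "((\<lambda>w. 1 / (w - a) + 1 / (w - cnj a) - 1 / (w - 0)) has_contour_integral (2 * pi * \<i> + 2 * pi * \<i> - 2 * pi * \<i>)) (circlepath 0 \<rho>)"
    by (intro has_contour_integral_add has_contour_integral_diff cauchy) (use a in auto)
  then have "((\<lambda>t. (1 / (U t - a) + 1 / (U t - cnj a) - 1 / (U t - 0)) * (2 * pi * \<i> * \<rho> * exp (2 * of_real pi * \<i> * t))) has_integral 2 * pi * \<i>) {0..1}"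
    by (simp add: has_contour_integral vector_derivative_circlepath U_def mult_ac)
  then have "((\<lambda>t. 1 / (ellipse_curve \<rho> t - x) * vector_derivative (ellipse_curve \<rho>) (at t)) has_integral 2 * pi * \<i>) {0..1}"
  proof (rule has_integral_eq[rotated])
    fix t :: real
    define u where "u = complex_of_real \<rho> * exp (2 * of_real pi * \<i> * t)"
    have u: "cmod u = \<rho>" using assms by (simp add: u_def norm_mult mult_ac)
    have Ut: "U t = u" by (simp add: U_def u_def circlepath)
    have nz: "u \<noteq> 0" "u - a \<noteq> 0" "u - cnj a \<noteq> 0" using a u assms by auto
    have e: "exp (- (\<i> * complex_of_real (2 * pi * t))) = 1 / exp (2 * of_real pi * \<i> * t)"
      by (simp add: exp_minus field_simps)
    have c: "ellipse_curve \<rho> t = (u + 1 / u) / 2"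
      unfolding ellipse_curve_def bernstein_path_def using e assms by (simp add: u_def field_simps)
    have d: "vector_derivative (ellipse_curve \<rho>) (at t) = 2 * pi * (\<i> * (u - 1 / u) / 2)"
      unfolding vector_derivative_ellipse_curve bernstein_path'_def using e assms by (simp add: u_def field_simps)
    have "(u - a) * (u - cnj a) = u\<^sup>2 - (a + cnj a) * u + a * cnj a" by (simp add: algebra_simps power2_eq_square)
    then have q: "(u - a) * (u - cnj a) = u\<^sup>2 - 2 * x * u + 1" using a by simp
    then have qnz: "u\<^sup>2 - 2 * x * u + 1 \<noteq> 0" using nz by (metis mult_eq_0_iff)
    have f: "(u + 1 / u) / 2 - x = (u\<^sup>2 - 2 * x * u + 1) / (2 * u)"
      using nz by (simp add: field_simps power2_eq_square)
    have "1 / (u - a) + 1 / (u - cnj a) = (2 * u - (a + cnj a)) / ((u - a) * (u - cnj a))"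
      using nz by (simp add: divide_simps)
    also have "\<dots> = (2 * u - 2 * x) / (u\<^sup>2 - 2 * x * u + 1)" using q a by simp
    finally have s1: "1 / (u - a) + 1 / (u - cnj a) = (2 * u - 2 * x) / (u\<^sup>2 - 2 * x * u + 1)" .
    have s: "1 / (u - a) + 1 / (u - cnj a) - 1 / u = (u\<^sup>2 - 1) / (u * (u\<^sup>2 - 2 * x * u + 1))"
      unfolding s1 using nz(1) qnz by (simp add: divide_simps) (simp add: algebra_simps power2_eq_square)
    have "(1 / (U t - a) + 1 / (U t - cnj a) - 1 / (U t - 0)) * (2 * pi * \<i> * \<rho> * exp (2 * of_real pi * \<i> * t))
        = (u\<^sup>2 - 1) / (u * (u\<^sup>2 - 2 * x * u + 1)) * (2 * pi * \<i> * u)"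
      unfolding Ut diff_0_right s by (simp add: u_def)
    also have "\<dots> = 1 / (ellipse_curve \<rho> t - x) * vector_derivative (ellipse_curve \<rho>) (at t)"
      unfolding c d f using nz qnz by (simp add: divide_simps) (simp add: algebra_simps power2_eq_square)
    finally show "(1 / (U t - a) + 1 / (U t - cnj a) - 1 / (U t - 0)) * (2 * pi * \<i> * \<rho> * exp (2 * of_real pi * \<i> * t))
       = 1 / (ellipse_curve \<rho> t - x) * vector_derivative (ellipse_curve \<rho>) (at t)" .
  qed
  then have "contour_integral (ellipse_curve \<rho>) (\<lambda>w. 1 / (w - x)) = 2 * pi * \<i>"
    by (intro contour_integral_unique) (simp add: has_contour_integral)
  moreover have "complex_of_real x \<notin> path_image (ellipse_curve \<rho>)"
    using bernstein_path_neq_real[OF assms] by (auto simp: path_image_def ellipse_curve_def) metis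
  ultimately show ?thesis
    by (simp add: winding_number_valid_path valid_path_ellipse_curve)
qed

lemma bernstein_Cauchy_formula:
  fixes x :: real
  assumes "\<rho> > 1" "f analytic_on bernstein_region \<rho>" "x \<in> {-1..1}"
  shows "((\<lambda>\<theta>. f (bernstein_path \<rho> \<theta>) * bernstein_path' \<rho> \<theta> / (bernstein_path \<rho> \<theta> - x)) has_integral
     (2 * pi * \<i> * f x)) {0..2*pi}"
proof -
  have "((\<lambda>w. f w / (w - x)) has_contour_integral (2 * pi * \<i> * winding_number (ellipse_curve \<rho>) x * f x)) (ellipse_curve \<rho>)"
  proof (rule Cauchy_integral_formula_convex_simple[OF convex_bernstein_region])
    show "f holomorphic_on bernstein_region \<rho>" using assms(2) by (rule analytic_imp_holomorphic)
    show "path_image (ellipse_curve \<rho>) \<subseteq> bernstein_region \<rho> - {complex_of_real x}"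
      using bernstein_path_neq_real[OF assms(1,3)] bernstein_path_focal_sum[of \<rho>] assms(1)
      by (auto simp: path_image_def ellipse_curve_def bernstein_region_def)
    show "pathfinish (ellipse_curve \<rho>) = pathstart (ellipse_curve \<rho>)"
      by (simp add: pathfinish_def pathstart_def ellipse_curve_def bernstein_path_def exp_minus mult_ac)
  qed (use assms real_in_interior_bernstein_region valid_path_ellipse_curve in auto)
  then have "((\<lambda>t. f (bernstein_path \<rho> (2 * pi * t)) / (bernstein_path \<rho> (2 * pi * t) - x) * (2 * pi * bernstein_path' \<rho> (2 * pi * t)))
       has_integral 2 * pi * \<i> * f x) (cbox 0 1)"
    by (simp add: has_contour_integral vector_derivative_ellipse_curve winding_number_ellipse_curve[OF assms(1,3)] ellipse_curve_def)
  from has_integral_affinity[OF this, of "1 / (2 * pi)" 0]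
  have "((\<lambda>\<theta>. f (bernstein_path \<rho> \<theta>) / (bernstein_path \<rho> \<theta> - x) * (2 * pi * bernstein_path' \<rho> \<theta>))
       has_integral 2 * pi * (2 * pi * \<i> * f x)) ((\<lambda>\<theta>. 2 * pi * \<theta>) ` {0..1})"
    by (simp add: scaleR_conv_of_real)
  moreover have "(\<lambda>\<theta>. 2 * pi * \<theta>) ` {0..1} = {0..2*pi}"
    by (simp add: image_mult_atLeastAtMost)
  ultimately have "((\<lambda>\<theta>. f (bernstein_path \<rho> \<theta>) / (bernstein_path \<rho> \<theta> - x) * (2 * pi * bernstein_path' \<rho> \<theta>))
       has_integral 2 * pi * (2 * pi * \<i> * f x)) {0..2*pi}" by simp
  from has_integral_mult_right[OF this, of "1 / (2 * pi)"] show ?thesis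
    by (simp add: field_simps)
qed

section \<open>Contour representation of the coefficients\<close>

text \<open>The preimage of the ellipse point with modulus below 1, that is v = 1/u for u = \<rho>
  exp(i \<theta>).\<close>

definition inverse_param :: "real \<Rightarrow> real \<Rightarrow> complex" where
  "inverse_param \<rho> \<theta> = complex_of_real (inverse \<rho>) * exp (- \<i> * complex_of_real \<theta>)"

lemma norm_inverse_param: "\<rho> > 0 \<Longrightarrow> norm (inverse_param \<rho> \<theta>) = inverse \<rho>"
  by (simp add: inverse_param_def norm_mult norm_inverse)

lemma bernstein_path_inverse_param:
  assumes "\<rho> > 0"
  shows "bernstein_path \<rho> \<theta> = (inverse_param \<rho> \<theta> + 1 / inverse_param \<rho> \<theta>) / 2"
  using assms unfolding bernstein_path_def inverse_param_def by (simp add: exp_minus field_simps)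

lemma continuous_on_inverse_param: "continuous_on A (inverse_param \<rho>)"
  unfolding inverse_param_def by (intro continuous_intros)

lemma continuous_on_gegenbauer_Q:
  assumes "l > 0"
  shows "continuous_on (ball 0 1) (gegenbauer_Q l n)"
proof -
  have "isCont (gegenbauer_Q l n) v" if v: "norm v < 1" for v
  proof -
    obtain K where K: "norm v < K" "K < 1" using dense[OF v] by auto
    then have K0: "0 \<le> K" using norm_ge_zero[of v] by linarith
    have "summable (\<lambda>k. complex_of_real (gegenbauer_Q_coeff l n k) * (complex_of_real (K\<^sup>2)) ^ k)"
      using sums_gegenbauer_Q_series[OF assms, of "complex_of_real K" n] K K0 by (auto simp: sums_iff)
    then have "isCont (\<lambda>w. \<Sum>k. complex_of_real (gegenbauer_Q_coeff l n k) * w ^ k) (v\<^sup>2)"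
      by (rule isCont_powser) (use K in \<open>simp add: norm_power power_strict_mono\<close>)
    then have "isCont (\<lambda>v. \<Sum>k. complex_of_real (gegenbauer_Q_coeff l n k) * (v\<^sup>2) ^ k) v"
      by (rule isCont_o2[rotated]) (intro continuous_intros)
    then show ?thesis unfolding gegenbauer_Q_def[abs_def] by (intro continuous_intros) auto
  qed
  then show ?thesis by (intro continuous_at_imp_continuous_on) auto
qed

lemma continuous_on_gegenbauer_Q_inverse_param:
  assumes "l > 0" "\<rho> > 1"
  shows "continuous_on A (\<lambda>\<theta>. gegenbauer_Q l n (inverse_param \<rho> \<theta>))"
  by (rule continuous_on_compose2[OF continuous_on_gegenbauer_Q[OF assms(1)] continuous_on_inverse_param])
     (use assms norm_inverse_param[of \<rho>] in \<open>auto simp: inverse_less_1_iff\<close>)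

lemma bernstein_path_in_region: "\<rho> > 0 \<Longrightarrow> bernstein_path \<rho> \<theta> \<in> bernstein_region \<rho>"
  using bernstein_path_focal_sum[of \<rho> \<theta>] by (simp add: bernstein_region_def)

lemma continuous_on_analytic_bernstein_path:
  assumes "\<rho> > 1" "f analytic_on bernstein_region \<rho>"
  shows "continuous_on A (\<lambda>\<theta>. f (bernstein_path \<rho> \<theta>))"
proof (rule continuous_on_compose2[of "bernstein_region \<rho>" f _ "bernstein_path \<rho>"])
  show "continuous_on (bernstein_region \<rho>) f"
    using assms(2) by (intro holomorphic_on_imp_continuous_on analytic_imp_holomorphic)
qed (use assms in \<open>auto intro: continuous_on_bernstein_path bernstein_path_in_region\<close>)

definition contour_coeff :: "real \<Rightarrow> real \<Rightarrow> (complex \<Rightarrow> complex) \<Rightarrow> nat \<Rightarrow> complex" where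
  "contour_coeff \<rho> l f n = 1 / (2 * pi * \<i>) *
     integral {0..2*pi} (\<lambda>\<theta>. f (bernstein_path \<rho> \<theta>) * bernstein_path' \<rho> \<theta> * gegenbauer_Q l n (inverse_param \<rho> \<theta>))"

lemma gegenbauer_sums_contour_coeff:
  assumes "\<rho> > 1" "l > 0" "f analytic_on bernstein_region \<rho>" "x \<in> {-1..1}"
  shows "(\<lambda>n. contour_coeff \<rho> l f n * complex_of_real (gegenbauer l n x)) sums f (complex_of_real x)"
proof -
  define g where "g \<theta> = f (bernstein_path \<rho> \<theta>) * bernstein_path' \<rho> \<theta>" for \<theta>
  define C where "C n = complex_of_real (gegenbauer l n x)" for n
  define J where "J n \<theta> = gegenbauer_Q l n (inverse_param \<rho> \<theta>)" for n \<theta>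
  define r where "r = inverse \<rho>"
  have r: "0 \<le> r" "r < 1" using assms(1) by (auto simp: r_def inverse_less_1_iff)
  have cg: "continuous_on A g" for A
    unfolding g_def by (intro continuous_intros continuous_on_analytic_bernstein_path continuous_on_bernstein_path' assms)
  have cJ: "continuous_on A (J n)" for A n
    unfolding J_def by (intro continuous_on_gegenbauer_Q_inverse_param assms)
  have "compact (g ` {0..2*pi})" by (intro compact_continuous_image cg) auto
  then obtain K where K: "\<And>\<theta>. \<theta> \<in> {0..2*pi} \<Longrightarrow> norm (g \<theta>) \<le> K"
    using compact_imp_bounded bounded_iff by (metis imageI)
  have K0: "K \<ge> 0" using K[of 0] order_trans[OF norm_ge_zero[of "g 0"]] by auto
  have maj: "norm (C n * J n \<theta>) \<le> gegenbauer_majorant l r n" for n \<theta>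
  proof -
    have "norm (C n * J n \<theta>) = \<bar>gegenbauer l n x\<bar> * norm (gegenbauer_Q l n (inverse_param \<rho> \<theta>))"
      by (simp add: C_def J_def norm_mult)
    also have "\<dots> \<le> gegenbauer_majorant l r n"
      by (rule norm_gegenbauer_Q_le_majorant) (use assms r abs_gegenbauer_le in \<open>auto simp: norm_inverse_param r_def\<close>)
    finally show ?thesis .
  qed
  have sm: "summable (gegenbauer_majorant l r)" by (rule summable_gegenbauer_majorant) (use assms r in auto)
  define F where "F N \<theta> = g \<theta> * (\<Sum>n<N. C n * J n \<theta>)" for N \<theta>
  have cF: "continuous_on {0..2*pi} (F N)" for N
    unfolding F_def by (intro continuous_intros cg cJ)
  \<comment> \<open>On the contour |v| is constantly 1/\<rho>, so one summable majorant serves all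
    \<theta>, and the remaining factor is bounded by compactness.\<close>
  have lim: "(\<lambda>N. integral {0..2*pi} (F N)) \<longlonglongrightarrow> integral {0..2*pi} (\<lambda>\<theta>. g \<theta> / (bernstein_path \<rho> \<theta> - x))"
  proof (rule dominated_convergence(2)[where h = "\<lambda>_. K * suminf (gegenbauer_majorant l r)"])
    show "F N integrable_on {0..2*pi}" for N
      by (rule integrable_continuous_interval[OF cF])
    show "norm (F N \<theta>) \<le> K * suminf (gegenbauer_majorant l r)" if "\<theta> \<in> {0..2*pi}" for N \<theta>
    proof -
      have "norm (\<Sum>n<N. C n * J n \<theta>) \<le> (\<Sum>n<N. gegenbauer_majorant l r n)"
        by (rule sum_norm_le) (rule maj)
      also have "\<dots> \<le> suminf (gegenbauer_majorant l r)"
        by (rule sum_le_suminf[OF sm]) (auto intro: order_trans[OF norm_ge_zero maj])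
      finally show ?thesis unfolding F_def norm_mult using K[OF that] K0 by (intro mult_mono) auto
    qed
    show "(\<lambda>N. F N \<theta>) \<longlonglongrightarrow> g \<theta> / (bernstein_path \<rho> \<theta> - x)" if "\<theta> \<in> {0..2*pi}" for \<theta>
    proof -
      have nv: "norm (inverse_param \<rho> \<theta>) = r" using assms by (simp add: norm_inverse_param r_def)
      have p: "bernstein_path \<rho> \<theta> = (inverse_param \<rho> \<theta> + 1 / inverse_param \<rho> \<theta>) / 2"
        by (rule bernstein_path_inverse_param) (use assms in auto)
      have "r \<noteq> 0" using assms by (simp add: r_def)
      then have "inverse_param \<rho> \<theta> \<noteq> 0" using nv by auto
      then have "(\<lambda>n. C n * J n \<theta>) sums (1 / (bernstein_path \<rho> \<theta> - x))"
        unfolding p C_def J_def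
        by (intro Cauchy_kernel_gegenbauer_sums) (use assms nv r bernstein_path_neq_real[OF assms(1,4), of \<theta>, unfolded p] in auto)
      from sums_mult[OF this, of "g \<theta>"] show ?thesis
        unfolding F_def sums_def by (simp add: sum_distrib_left)
    qed
  qed auto
  have "integral {0..2*pi} (F N) = 2 * pi * \<i> * (\<Sum>n<N. contour_coeff \<rho> l f n * C n)" for N
  proof -
    have "((\<lambda>\<theta>. \<Sum>n<N. C n * (g \<theta> * J n \<theta>)) has_integral (\<Sum>n<N. C n * integral {0..2*pi} (\<lambda>\<theta>. g \<theta> * J n \<theta>))) {0..2*pi}"
      by (intro has_integral_sum has_integral_mult_right integrable_integral integrable_continuous_interval continuous_intros cg cJ) auto
    moreover have "(\<lambda>\<theta>. \<Sum>n<N. C n * (g \<theta> * J n \<theta>)) = F N"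
      by (simp add: F_def fun_eq_iff sum_distrib_left mult_ac)
    moreover have "2 * pi * \<i> * contour_coeff \<rho> l f n = integral {0..2*pi} (\<lambda>\<theta>. g \<theta> * J n \<theta>)" for n
      by (simp add: contour_coeff_def g_def J_def)
    ultimately show ?thesis by (simp add: integral_unique sum_distrib_left mult_ac)
  qed
  moreover have "integral {0..2*pi} (\<lambda>\<theta>. g \<theta> / (bernstein_path \<rho> \<theta> - x)) = 2 * pi * \<i> * f x"
    using bernstein_Cauchy_formula[OF assms(1,3,4)] by (simp add: g_def integral_unique)
  ultimately have "(\<lambda>N. 2 * pi * \<i> * (\<Sum>n<N. contour_coeff \<rho> l f n * C n)) \<longlonglongrightarrow> 2 * pi * \<i> * f x"
    using lim by simp
  from tendsto_mult_left[OF this, of "1 / (2 * pi * \<i>)"] show ?thesis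
    unfolding sums_def C_def by (simp add: field_simps)
qed

section \<open>Size of the contour coefficients and their identification\<close>

lemma bernstein_ellipse_bound:
  assumes "\<rho> > 1" "f analytic_on bernstein_region \<rho>" "\<theta> \<in> {0..2*pi}"
  shows "cmod (f (bernstein_path \<rho> \<theta>)) \<le> (SUP z\<in>bernstein_ellipse \<rho>. cmod (f z))"
proof (rule cSUP_upper)
  show "bernstein_path \<rho> \<theta> \<in> bernstein_ellipse \<rho>" using assms by (auto simp: bernstein_ellipse_def)
  have "compact ((\<lambda>\<theta>. cmod (f (bernstein_path \<rho> \<theta>))) ` {0..2*pi})"
    by (intro compact_continuous_image continuous_intros continuous_on_analytic_bernstein_path assms) auto
  then have "bdd_above ((\<lambda>\<theta>. cmod (f (bernstein_path \<rho> \<theta>))) ` {0..2*pi})"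
    by (intro bounded_imp_bdd_above compact_imp_bounded)
  then show "bdd_above ((\<lambda>z. cmod (f z)) ` bernstein_ellipse \<rho>)"
    by (simp add: bernstein_ellipse_def image_image)
qed

text \<open>The bound q is left open because two are inserted: the crude majorant to justify
  integrating the expansion, and the extremal value for the final estimate.\<close>

lemma norm_contour_coeff_le:
  assumes "\<rho> > 1" "l > 0" "f analytic_on bernstein_region \<rho>"
    and q: "\<And>v. norm v = inverse \<rho> \<Longrightarrow> norm (gegenbauer_Q l n v) \<le> q"
  defines "M \<equiv> (SUP z\<in>bernstein_ellipse \<rho>. cmod (f z))"
  shows "norm (contour_coeff \<rho> l f n) \<le> M * bernstein_length \<rho> / (2 * pi) * q"
proof -
  have M0: "M \<ge> 0" unfolding M_def using bernstein_ellipse_bound[OF assms(1,3), of 0]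
    by (auto intro: order_trans[OF norm_ge_zero])
  have "norm (integral {0..2*pi} (\<lambda>\<theta>. f (bernstein_path \<rho> \<theta>) * bernstein_path' \<rho> \<theta> * gegenbauer_Q l n (inverse_param \<rho> \<theta>)))
     \<le> integral {0..2*pi} (\<lambda>\<theta>. M * q * norm (bernstein_path' \<rho> \<theta>))"
  proof (rule integral_norm_bound_integral)
    show "(\<lambda>\<theta>. f (bernstein_path \<rho> \<theta>) * bernstein_path' \<rho> \<theta> * gegenbauer_Q l n (inverse_param \<rho> \<theta>)) integrable_on {0..2*pi}"
      by (intro integrable_continuous_interval continuous_intros continuous_on_analytic_bernstein_path
          continuous_on_bernstein_path' continuous_on_gegenbauer_Q_inverse_param assms)
    show "(\<lambda>\<theta>. M * q * norm (bernstein_path' \<rho> \<theta>)) integrable_on {0..2*pi}"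
      by (intro integrable_continuous_interval continuous_intros continuous_on_bernstein_path')
    fix \<theta> :: real assume \<theta>: "\<theta> \<in> {0..2*pi}"
    have "norm (f (bernstein_path \<rho> \<theta>)) * norm (gegenbauer_Q l n (inverse_param \<rho> \<theta>)) \<le> M * q"
      unfolding M_def using bernstein_ellipse_bound[OF assms(1,3) \<theta>] q[of "inverse_param \<rho> \<theta>"] assms(1) M0
      by (intro mult_mono) (auto simp: norm_inverse_param M_def)
    from mult_right_mono[OF this norm_ge_zero[of "bernstein_path' \<rho> \<theta>"]]
    show "norm (f (bernstein_path \<rho> \<theta>) * bernstein_path' \<rho> \<theta> * gegenbauer_Q l n (inverse_param \<rho> \<theta>)) \<le> M * q * norm (bernstein_path' \<rho> \<theta>)"
      by (simp add: norm_mult mult_ac)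
  qed
  also have "\<dots> = M * q * bernstein_length \<rho>"
    unfolding bernstein_length_def vector_derivative_at[OF bernstein_path_has_vector_derivative] by simp
  finally have "norm (integral {0..2*pi} (\<lambda>\<theta>. f (bernstein_path \<rho> \<theta>) * bernstein_path' \<rho> \<theta> * gegenbauer_Q l n (inverse_param \<rho> \<theta>))) / (2 * pi)
     \<le> M * q * bernstein_length \<rho> / (2 * pi)" by (intro divide_right_mono) auto
  then show ?thesis unfolding contour_coeff_def by (simp add: norm_mult norm_divide mult_ac)
qed

lemma bernstein_bound_nonneg:
  assumes "\<rho> > 1" "f analytic_on bernstein_region \<rho>"
  shows "(SUP z\<in>bernstein_ellipse \<rho>. cmod (f z)) * bernstein_length \<rho> \<ge> 0"
proof (rule mult_nonneg_nonneg)
  show "(SUP z\<in>bernstein_ellipse \<rho>. cmod (f z)) \<ge> 0"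
    using bernstein_ellipse_bound[OF assms, of 0] by (auto intro: order_trans[OF norm_ge_zero])
  show "bernstein_length \<rho> \<ge> 0"
    unfolding bernstein_length_def vector_derivative_at[OF bernstein_path_has_vector_derivative]
    by (intro integral_nonneg integrable_continuous_interval continuous_intros continuous_on_bernstein_path') auto
qed

lemma gegenbauer_coeff_eq_contour_coeff:
  assumes "\<rho> > 1" "l > 0" "f analytic_on bernstein_region \<rho>"
  shows "gegenbauer_coeff l f n = contour_coeff \<rho> l f n"
proof -
  define r where "r = inverse \<rho>"
  have r: "0 \<le> r" "r < 1" using assms(1) by (auto simp: r_def inverse_less_1_iff)
  define b where "b = contour_coeff \<rho> l f"
  define w where "w = (\<lambda>x::real. (1 - x\<^sup>2) powr (l - 1/2))"
  define A where "A = (SUP z\<in>bernstein_ellipse \<rho>. cmod (f z)) * bernstein_length \<rho> / (2 * pi)"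
  have A0: "A \<ge> 0" unfolding A_def using bernstein_bound_nonneg[OF assms(1,3)] by simp
  have bb: "norm (b m * complex_of_real (gegenbauer l m x)) \<le> A * gegenbauer_majorant l r m" if "x \<in> {-1..1}" for m x
  proof -
    have p: "pochhammer (2 * l) m / fact m > 0" using assms by (intro divide_pos_pos pochhammer_pos) auto
    \<comment> \<open>The majorant estimates the product C_m Q_m, so a bound on the coefficient
      alone requires dividing by the maximum of C_m; the factor returns when the polynomial is
      bounded.\<close>
    have "norm (b m) \<le> A * (gegenbauer_majorant l r m / (pochhammer (2 * l) m / fact m))"
      unfolding b_def A_def
    proof (rule norm_contour_coeff_le[OF assms])
      fix v :: complex assume "norm v = inverse \<rho>"
      then have "pochhammer (2 * l) m / fact m * norm (gegenbauer_Q l m v) \<le> gegenbauer_majorant l r m"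
        using r assms by (intro norm_gegenbauer_Q_le_majorant) (auto simp: r_def)
      then show "norm (gegenbauer_Q l m v) \<le> gegenbauer_majorant l r m / (pochhammer (2 * l) m / fact m)"
        unfolding pos_le_divide_eq[OF p] by (simp only: mult.commute)
    qed
    then have "norm (b m) * norm (complex_of_real (gegenbauer l m x)) \<le>
        A * (gegenbauer_majorant l r m / (pochhammer (2 * l) m / fact m)) * (pochhammer (2 * l) m / fact m)"
      using abs_gegenbauer_le[OF assms(2) that, of m] by (intro mult_mono) (auto intro: order_trans[OF norm_ge_zero])
    moreover have "gegenbauer_majorant l r m / (pochhammer (2 * l) m / fact m) * (pochhammer (2 * l) m / fact m) = gegenbauer_majorant l r m"
      using nonzero_eq_divide_eq[of "pochhammer (2 * l) m / fact m"] p by (metis less_irrefl)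
    ultimately show ?thesis by (simp only: norm_mult mult.assoc)
  qed
  have sm: "summable (gegenbauer_majorant l r)" by (rule summable_gegenbauer_majorant) (use assms r in auto)
  have maj0: "gegenbauer_majorant l r m \<ge> 0" for m
    unfolding gegenbauer_majorant_def using r assms gegenbauer_Q_bound_nonneg[OF r, of l]
    by (intro mult_nonneg_nonneg divide_nonneg_pos) (auto intro: pochhammer_nonneg)
  have wint: "w integrable_on {-1..1}"
    using has_integral_gegenbauer_weight[OF assms(2)] unfolding w_def integrable_on_def by blast
  have w0: "w x \<ge> 0" for x by (simp add: w_def)
  define P where "P = pochhammer (2 * l) n / fact n"
  define F where "F N x = complex_of_real (w x * gegenbauer l n x) * (\<Sum>m<N. b m * complex_of_real (gegenbauer l m x))" for N x
  have Fint: "(F N has_integral (\<Sum>m<N. b m * (if m = n then gegenbauer_h l n else 0))) {-1..1}" for N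
  proof -
    have "((\<lambda>x. complex_of_real (w x * (gegenbauer l n x * gegenbauer l m x))) has_integral
        complex_of_real (if m = n then gegenbauer_h l n else 0)) {-1..1}" for m
    proof (rule has_integral_of_real)
      have "((\<lambda>x. w x * (gegenbauer l n x * gegenbauer l m x)) has_integral gegenbauer_integral l (\<lambda>x. gegenbauer l n x * gegenbauer l m x)) {-1..1}"
        unfolding w_def by (intro has_integral_gegenbauer_integral assms continuous_intros)
      then show "((\<lambda>x. w x * (gegenbauer l n x * gegenbauer l m x)) has_integral (if m = n then gegenbauer_h l n else 0)) {-1..1}"
        using gegenbauer_square_integral[OF assms(2), of n] gegenbauer_orthogonal[OF assms(2), of n m] by (cases "m = n") auto
    qed
    then have "((\<lambda>x. \<Sum>m<N. b m * complex_of_real (w x * (gegenbauer l n x * gegenbauer l m x))) has_integral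
        (\<Sum>m<N. b m * complex_of_real (if m = n then gegenbauer_h l n else 0))) {-1..1}"
      by (intro has_integral_sum has_integral_mult_right) auto
    moreover have "(\<lambda>x. \<Sum>m<N. b m * complex_of_real (w x * (gegenbauer l n x * gegenbauer l m x))) = F N"
      by (simp add: F_def fun_eq_iff sum_distrib_left mult_ac)
    ultimately show ?thesis by simp
  qed
  \<comment> \<open>The expansion converges under a bound uniform in x, so the integrable weight
    times a constant dominates, even where the weight is unbounded.\<close>
  have lim: "(\<lambda>N. integral {-1..1} (F N)) \<longlonglongrightarrow> integral {-1..1} (\<lambda>x. complex_of_real (w x * gegenbauer l n x) * f (complex_of_real x))"
  proof (rule dominated_convergence(2)[where h = "\<lambda>x. w x * (P * (A * suminf (gegenbauer_majorant l r)))"])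
    show "F N integrable_on {-1..1}" for N using Fint[of N] by (auto simp: integrable_on_def)
    show "(\<lambda>x. w x * (P * (A * suminf (gegenbauer_majorant l r)))) integrable_on {-1..1}"
      using wint by (rule integrable_on_mult_left)
    show "norm (F N x) \<le> w x * (P * (A * suminf (gegenbauer_majorant l r)))" if "x \<in> {-1..1}" for N x
    proof -
      have "norm (\<Sum>m<N. b m * complex_of_real (gegenbauer l m x)) \<le> (\<Sum>m<N. A * gegenbauer_majorant l r m)"
        by (rule sum_norm_le) (rule bb[OF that])
      also have "\<dots> \<le> A * suminf (gegenbauer_majorant l r)"
        unfolding sum_distrib_left[symmetric] by (intro mult_left_mono sum_le_suminf[OF sm] A0) (auto simp: maj0)
      finally have "\<bar>gegenbauer l n x\<bar> * norm (\<Sum>m<N. b m * complex_of_real (gegenbauer l m x)) \<le> P * (A * suminf (gegenbauer_majorant l r))"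
        using abs_gegenbauer_le[OF assms(2) that, of n] unfolding P_def
        by (intro mult_mono) (auto intro: order_trans[OF abs_ge_zero])
      then show ?thesis unfolding F_def using w0[of x] by (simp add: norm_mult abs_mult mult_left_mono mult.assoc)
    qed
    show "(\<lambda>N. F N x) \<longlonglongrightarrow> complex_of_real (w x * gegenbauer l n x) * f (complex_of_real x)" if "x \<in> {-1..1}" for x
      unfolding F_def using gegenbauer_sums_contour_coeff[OF assms that]
      by (intro tendsto_mult_left) (simp add: sums_def b_def)
  qed
  \<comment> \<open>Once N exceeds n, orthogonality leaves only the term m = n, so the integrals are
    eventually constant.\<close>
  have "eventually (\<lambda>N. integral {-1..1} (F N) = b n * gegenbauer_h l n) sequentially"
    using eventually_gt_at_top[of n]
  proof eventually_elim
    case (elim N)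
    have "integral {-1..1} (F N) = (\<Sum>m<N. b m * (if m = n then gegenbauer_h l n else 0))"
      by (rule integral_unique[OF Fint])
    also have "\<dots> = (\<Sum>m<N. if m = n then b n * gegenbauer_h l n else 0)"
      by (intro sum.cong) auto
    also have "\<dots> = b n * gegenbauer_h l n" using elim by (simp add: sum.delta)
    finally show ?case .
  qed
  then have "(\<lambda>N. integral {-1..1} (F N)) \<longlonglongrightarrow> b n * gegenbauer_h l n"
    by (rule tendsto_eventually)
  with lim have int: "integral {-1..1} (\<lambda>x. complex_of_real (w x * gegenbauer l n x) * f (complex_of_real x)) = b n * gegenbauer_h l n"
    by (rule LIMSEQ_unique)
  have cf: "continuous_on {-1..1} (\<lambda>x. f (complex_of_real x))"
  proof (rule continuous_on_compose2[of "bernstein_region \<rho>" f])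
    show "continuous_on (bernstein_region \<rho>) f"
      using assms(3) by (intro holomorphic_on_imp_continuous_on analytic_imp_holomorphic)
    show "complex_of_real ` {-1..1} \<subseteq> bernstein_region \<rho>"
      using real_in_interior_bernstein_region[OF assms(1)] interior_subset by blast
  qed (intro continuous_intros)
  \<comment> \<open>The coefficient is a Lebesgue interval integral, the limit above a gauge
    integral. Absolute integrability settles the completed measure, and Borel measurability
    transfers it to \<open>lborel\<close>, where the two integrals agree.\<close>
  define h where "h x = complex_of_real (w x * gegenbauer l n x) * f (complex_of_real x)" for x
  have "(\<lambda>x. w x *\<^sub>R (complex_of_real (gegenbauer l n x) * f (complex_of_real x))) absolutely_integrable_on {-1..1}"
    unfolding w_def by (intro absolutely_integrable_gegenbauer_weight assms continuous_intros cf)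
  then have "integrable lebesgue (\<lambda>x. indicator {-1..1} x *\<^sub>R h x)"
    unfolding set_integrable_def h_def by (simp add: scaleR_conv_of_real mult.assoc)
  moreover have "(\<lambda>x. indicator {-1..1} x *\<^sub>R h x) \<in> borel_measurable lborel"
  proof -
    have 1: "(\<lambda>x. indicator {-1..1} x *\<^sub>R (complex_of_real (gegenbauer l n x) * f (complex_of_real x))) \<in> borel_measurable borel"
      by (intro borel_measurable_continuous_on_indicator continuous_intros cf) auto
    have 2: "w \<in> borel_measurable borel" unfolding w_def by measurable
    have "(\<lambda>x. w x *\<^sub>R (indicator {-1..1} x *\<^sub>R (complex_of_real (gegenbauer l n x) * f (complex_of_real x)))) \<in> borel_measurable borel"
      by (intro borel_measurable_scaleR 1 2)
    then show ?thesis by (simp add: h_def scaleR_conv_of_real mult_ac)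
  qed
  ultimately have "set_integrable lborel {-1..1} h"
    unfolding set_integrable_def by (simp add: integrable_completion)
  from interval_integral_eq_integral[OF _ this]
  have "(LBINT x = -1..1. h x) = integral {-1..1} h" by (simp add: one_ereal_def)
  then have "gegenbauer_coeff l f n = complex_of_real (1 / gegenbauer_h l n) * (b n * gegenbauer_h l n)"
    unfolding gegenbauer_coeff_def int[symmetric] h_def w_def by simp
  then show ?thesis using gegenbauer_h_pos[OF assms(2), of n] by (simp add: b_def)
qed

section \<open>The remainder bound\<close>

text \<open>Both ranges of the parameter at once: \<open>v\<^sub>0\<close> is the point of |v| =
  1/\<rho> with real square y at which the hypergeometric factor is largest, and only the proof of
  extremality differs.\<close>

lemma gegenbauer_remainder_bound:
  fixes \<rho> l y x :: real and v\<^sub>0 :: complex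
  assumes "\<rho> > 1" "l > 0" "f analytic_on bernstein_region \<rho>" "x \<in> {-1..1}"
    and v0: "norm v\<^sub>0 = inverse \<rho>" "v\<^sub>0\<^sup>2 = complex_of_real y"
    and extremal: "\<And>n v. norm v = inverse \<rho> \<Longrightarrow>
      norm (\<Sum>k. complex_of_real (gauss_coeff l n k) * (v\<^sup>2) ^ k) \<le> hyp2F1 (real n + 1) (1 - l) (real n + l + 1) y"
  defines "M \<equiv> (SUP z\<in>bernstein_ellipse \<rho>. cmod (f z))"
  shows "cmod (f (complex_of_real x) - gegenbauer_partial l f N x)
       \<le> M * bernstein_length \<rho> * Gamma l / (pi * Gamma (2 * l)) *
         (\<Sum>k. Gamma (real (k + N) + 2 * l) / (Gamma (real (k + N) + l) * \<rho> ^ (k + N + 1))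
              * hyp2F1 (real (k + N) + 1) (1 - l) (real (k + N) + l + 1) y)"
proof -
  define r where "r = inverse \<rho>"
  have r: "0 < r" "r < 1" using assms(1) by (auto simp: r_def inverse_less_1_iff)
  define H where "H n = hyp2F1 (real n + 1) (1 - l) (real n + l + 1) y" for n
  define A where "A = M * bernstein_length \<rho>"
  have A0: "A \<ge> 0" unfolding A_def M_def by (rule bernstein_bound_nonneg[OF assms(1,3)])
  define T where "T n = Gamma (real n + 2 * l) / (Gamma (real n + l) * \<rho> ^ (n + 1)) * H n" for n
  define q where "q n = 2 * fact n / pochhammer l n * r ^ (n + 1) * H n" for n
  define a where "a n = contour_coeff \<rho> l f n * complex_of_real (gegenbauer l n x)" for n
  define p where "p n = pochhammer (2 * l) n / fact n" for n
  have pos: "pochhammer l n > 0" "pochhammer (2 * l) n > 0" "Gamma l > 0" "Gamma (2 * l) > 0" "p n > 0" for n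
    using assms(2) by (auto intro!: pochhammer_pos Gamma_real_pos divide_pos_pos simp: p_def)
  have H0: "H n \<ge> 0" for n
    unfolding H_def using order_trans[OF norm_ge_zero extremal[OF v0(1)]] .
  have jq: "norm (gegenbauer_Q l n v) \<le> q n" if "norm v = r" for n v
  proof -
    have "norm (gegenbauer_Q l n v) = 2 * fact n / pochhammer l n * r ^ (n + 1) * norm (\<Sum>k. complex_of_real (gauss_coeff l n k) * (v\<^sup>2) ^ k)"
      using gegenbauer_Q_eq_gauss(2)[OF assms(2), of v n] that r pos(1)[of n]
      by (simp only: norm_mult norm_power norm_of_real) simp
    also have "\<dots> \<le> q n"
      unfolding q_def H_def using r pos(1)[of n] extremal[of v n] that by (intro mult_left_mono) (auto simp: r_def)
    finally show ?thesis .
  qed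
  \<comment> \<open>The bound \<open>q\<close> is attained at \<open>v\<^sub>0\<close>, hence lies
    under the summable majorant; this gives convergence of the series on the right side of the
    theorem.\<close>
  have j0: "norm (gegenbauer_Q l n v\<^sub>0) = q n" for n
  proof -
    have n0: "norm v\<^sub>0 < 1" using v0 r by (simp add: r_def)
    have "norm (gegenbauer_Q l n v\<^sub>0) = 2 * fact n / pochhammer l n * r ^ (n + 1) * norm (complex_of_real (H n))"
      using gegenbauer_Q_eq_gauss(2)[OF assms(2) n0, of n] v0 pos(1)[of n]
      unfolding gauss_sum_of_real[OF assms(2) n0 v0(2)] H_def
      by (simp only: norm_mult norm_power norm_of_real r_def) simp
    then show ?thesis using H0[of n] by (simp add: q_def)
  qed
  \<comment> \<open>The factors n! in \<open>p\<close> and \<open>q\<close> cancel, and the 2 in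
    \<open>q\<close> cancels against 2 pi from Cauchy's formula; this is the origin of the
    constant.\<close>
  have T: "Gamma l / (pi * Gamma (2 * l)) * T n = p n * q n / (2 * pi)" for n
  proof -
    have "Gamma (real n + 2 * l) = pochhammer (2 * l) n * Gamma (2 * l)" "Gamma (real n + l) = pochhammer l n * Gamma l"
      using Gamma_add_nat[of "2 * l" n] Gamma_add_nat[of l n] assms(2) by (simp_all add: add.commute)
    moreover have "inverse \<rho> ^ (n + 1) = 1 / \<rho> ^ (n + 1)" by (simp add: power_inverse divide_inverse)
    ultimately show ?thesis unfolding T_def q_def r_def p_def
      using pos(1)[of n] pos(3,4) assms(1) by (simp add: divide_simps)
  qed
  have sp: "summable (\<lambda>n. p n * q n)"
  proof (rule summable_comparison_test'[OF summable_gegenbauer_majorant[OF assms(2)]])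
    show "norm (p n * q n) \<le> gegenbauer_majorant l r n" for n
    proof -
      have "norm (p n * q n) = p n * norm (gegenbauer_Q l n v\<^sub>0)"
        unfolding j0[symmetric] using pos(5)[of n] by (simp add: abs_mult)
      also have "\<dots> \<le> gegenbauer_majorant l r n"
        by (rule norm_gegenbauer_Q_le_majorant) (use assms(2) v0 r in \<open>auto simp: p_def r_def\<close>)
      finally show ?thesis .
    qed
  qed (use r in auto)
  then have sT: "summable (\<lambda>n. Gamma l / (pi * Gamma (2 * l)) * T n)"
    unfolding T by (rule summable_divide)
  have "Gamma l / (pi * Gamma (2 * l)) \<noteq> 0" using pos(3,4) by simp
  with sT have sT': "summable T" unfolding summable_cmult_iff by blast
  have an: "norm (a n) \<le> A * (Gamma l / (pi * Gamma (2 * l)) * T n)" for n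
  proof -
    have "norm (contour_coeff \<rho> l f n) \<le> A / (2 * pi) * q n"
      unfolding A_def M_def by (rule norm_contour_coeff_le[OF assms(1-3)]) (use jq r_def in auto)
    then have "norm (a n) \<le> A / (2 * pi) * q n * p n"
      using abs_gegenbauer_le[OF assms(2,4), of n] unfolding a_def norm_mult norm_of_real p_def
      by (intro mult_mono) (auto intro: order_trans[OF norm_ge_zero])
    then show ?thesis unfolding T by (simp add: mult_ac)
  qed
  have "a sums f (complex_of_real x)"
    unfolding a_def by (rule gegenbauer_sums_contour_coeff[OF assms(1-4)])
  moreover have "gegenbauer_partial l f N x = (\<Sum>n<N. a n)"
    by (simp add: gegenbauer_partial_def a_def gegenbauer_coeff_eq_contour_coeff[OF assms(1-3)])
  ultimately have "(\<lambda>k. a (k + N)) sums (f (complex_of_real x) - gegenbauer_partial l f N x)"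
    by (simp add: sums_iff_shift)
  then have "cmod (f (complex_of_real x) - gegenbauer_partial l f N x) = norm (\<Sum>k. a (k + N))"
    by (simp add: sums_iff)
  also have "\<dots> \<le> (\<Sum>k. A * (Gamma l / (pi * Gamma (2 * l)) * T (k + N)))"
    by (rule norm_suminf_le[OF an]) (intro summable_mult summable_ignore_initial_segment sT')
  also have "\<dots> = A * (Gamma l / (pi * Gamma (2 * l))) * (\<Sum>k. T (k + N))"
    unfolding mult.assoc[symmetric] by (rule suminf_mult) (intro summable_ignore_initial_segment sT')
  finally show ?thesis by (simp add: A_def T_def H_def)
qed

section \<open>Closed form at parameter 1 and the three estimates\<close>

lemma hyp2F1_0: "hyp2F1 a 0 c z = 1"
proof -
  have "hyp2F1 a 0 c z = (\<Sum>k\<in>{0}. pochhammer a k * pochhammer 0 k / (pochhammer c k * fact k) * z ^ k)"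
    unfolding hyp2F1_def by (intro suminf_finite) (auto simp: pochhammer_0_left)
  then show ?thesis by simp
qed

text \<open>Writing k + N + 1 as (k + 1) + N splits the series into the derivative of a geometric
  series and N times a geometric series.\<close>

lemma shifted_geometric_deriv_sums:
  fixes \<rho> :: real
  assumes "\<rho> > 1"
  shows "(\<lambda>k. (real (k + N) + 1) / \<rho> ^ (k + N + 1)) sums (1 / \<rho> ^ N * ((real N * (\<rho> - 1) + \<rho>) / (\<rho> - 1)\<^sup>2))"
proof -
  define r where "r = inverse \<rho>"
  have r: "norm r < 1" "r < 1" "\<rho> * r = 1" using assms by (auto simp: r_def inverse_less_1_iff)
  have "(\<lambda>k. r ^ (N + 1) * (real (Suc k) * r ^ k + real N * r ^ k)) sums (r ^ (N + 1) * (1 / (1 - r)\<^sup>2 + real N * (1 / (1 - r))))"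
    by (intro sums_mult sums_add geometric_deriv_sums geometric_sums r)
  moreover have "r ^ (N + 1) * (real (Suc k) * r ^ k + real N * r ^ k) = (real (k + N) + 1) / \<rho> ^ (k + N + 1)" for k
    by (simp add: r_def power_inverse power_add divide_inverse algebra_simps)
  moreover have "r ^ (N + 1) * (1 / (1 - r)\<^sup>2 + real N * (1 / (1 - r))) = 1 / \<rho> ^ N * ((real N * (\<rho> - 1) + \<rho>) / (\<rho> - 1)\<^sup>2)"
  proof -
    have e: "1 - r = (\<rho> - 1) / \<rho>" using assms by (simp add: r_def field_simps)
    have "r ^ (N + 1) = 1 / \<rho> ^ N * (1 / \<rho>)" by (simp add: r_def power_inverse divide_inverse)
    then have "r ^ (N + 1) * (1 / (1 - r)\<^sup>2 + real N * (1 / (1 - r))) = 1 / \<rho> ^ N * (1 / \<rho> * (1 / (1 - r)\<^sup>2 + real N * (1 / (1 - r))))"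
      by (simp only: mult.assoc)
    also have "1 / \<rho> * (1 / (1 - r)\<^sup>2 + real N * (1 / (1 - r))) = (real N * (\<rho> - 1) + \<rho>) / (\<rho> - 1)\<^sup>2"
      unfolding e using assms by (simp add: divide_simps power2_eq_square) (simp add: algebra_simps)
    finally show ?thesis .
  qed
  ultimately show ?thesis by simp
qed

theorem theorem4p5:
  fixes \<rho> lam :: real and f :: "complex \<Rightarrow> complex" and N :: nat and x :: real
  assumes "\<rho> > 1"
    and "f analytic_on bernstein_region \<rho>"
    and "x \<in> {-1..1}"
  defines "M \<equiv> (SUP z\<in>bernstein_ellipse \<rho>. cmod (f z))"
    and "L \<equiv> bernstein_length \<rho>"
  shows
    "(0 < lam \<and> lam \<le> 1 \<longrightarrow>
       cmod (f (complex_of_real x) - gegenbauer_partial lam f N x)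
       \<le> M * L * Gamma lam / (pi * Gamma (2 * lam)) *
         (\<Sum>k. Gamma (real (k + N) + 2 * lam) / (Gamma (real (k + N) + lam) * \<rho> ^ (k + N + 1))
              * hyp2F1 (real (k + N) + 1) (1 - lam) (real (k + N) + lam + 1) (1 / \<rho>\<^sup>2)))
   \<and> (lam = 1 \<longrightarrow>
       cmod (f (complex_of_real x) - gegenbauer_partial lam f N x)
       \<le> M * L / (pi * \<rho> ^ N) * ((real N * (\<rho> - 1) + \<rho>) / (\<rho> - 1)\<^sup>2))
   \<and> (lam > 1 \<longrightarrow>
       cmod (f (complex_of_real x) - gegenbauer_partial lam f N x)
       \<le> M * L * Gamma lam / (pi * Gamma (2 * lam)) *
         (\<Sum>k. Gamma (real (k + N) + 2 * lam) / (Gamma (real (k + N) + lam) * \<rho> ^ (k + N + 1))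
              * hyp2F1 (real (k + N) + 1) (1 - lam) (real (k + N) + lam + 1) (- 1 / \<rho>\<^sup>2)))"
proof (intro conjI impI)
  have nr: "inverse \<rho> < 1" "0 \<le> inverse \<rho>" using assms(1) by (auto simp: inverse_less_1_iff)
  have small: "cmod (f (complex_of_real x) - gegenbauer_partial lam f N x)
       \<le> M * L * Gamma lam / (pi * Gamma (2 * lam)) *
         (\<Sum>k. Gamma (real (k + N) + 2 * lam) / (Gamma (real (k + N) + lam) * \<rho> ^ (k + N + 1))
              * hyp2F1 (real (k + N) + 1) (1 - lam) (real (k + N) + lam + 1) (1 / \<rho>\<^sup>2))"
    if "0 < lam \<and> lam \<le> 1"
    unfolding M_def L_def
  proof (rule gegenbauer_remainder_bound[OF assms(1) _ assms(2,3), of _ "complex_of_real (inverse \<rho>)"])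
    show "(complex_of_real (inverse \<rho>))\<^sup>2 = complex_of_real (1 / \<rho>\<^sup>2)"
      by (simp add: power_inverse divide_inverse)
    show "norm (\<Sum>k. complex_of_real (gauss_coeff lam n k) * (v\<^sup>2) ^ k) \<le> hyp2F1 (real n + 1) (1 - lam) (real n + lam + 1) (1 / \<rho>\<^sup>2)"
      if "norm v = inverse \<rho>" for n v
      using norm_gauss_sum_le_of_le_1[of lam v n] \<open>0 < lam \<and> lam \<le> 1\<close> that nr by (simp add: power_inverse divide_inverse)
  qed (use that assms(1) in \<open>auto simp: norm_inverse\<close>)
  then show "0 < lam \<and> lam \<le> 1 \<Longrightarrow> cmod (f (complex_of_real x) - gegenbauer_partial lam f N x)
       \<le> M * L * Gamma lam / (pi * Gamma (2 * lam)) *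
         (\<Sum>k. Gamma (real (k + N) + 2 * lam) / (Gamma (real (k + N) + lam) * \<rho> ^ (k + N + 1))
              * hyp2F1 (real (k + N) + 1) (1 - lam) (real (k + N) + lam + 1) (1 / \<rho>\<^sup>2))" .
  show "cmod (f (complex_of_real x) - gegenbauer_partial lam f N x)
       \<le> M * L / (pi * \<rho> ^ N) * ((real N * (\<rho> - 1) + \<rho>) / (\<rho> - 1)\<^sup>2)" if lam: "lam = 1"
  proof -
    \<comment> \<open>At parameter 1 the Gamma quotient is Gamma(n + 2) / Gamma(n + 1) = n + 1, and
      the second hypergeometric parameter is 0, which reduces the series to 1.\<close>
    have term_eq: "Gamma (real (k + N) + 2 * lam) / (Gamma (real (k + N) + lam) * \<rho> ^ (k + N + 1))
        * hyp2F1 (real (k + N) + 1) (1 - lam) (real (k + N) + lam + 1) (1 / \<rho>\<^sup>2) = (real (k + N) + 1) / \<rho> ^ (k + N + 1)" for k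
      unfolding lam using Gamma_plus1_pos[of "real (k + N) + 1"] Gamma_pos_neq_0[of "real (k + N) + 1"]
      by (simp add: add.assoc hyp2F1_0)
    have "cmod (f (complex_of_real x) - gegenbauer_partial lam f N x)
       \<le> M * L * Gamma lam / (pi * Gamma (2 * lam)) * (1 / \<rho> ^ N * ((real N * (\<rho> - 1) + \<rho>) / (\<rho> - 1)\<^sup>2))"
      using small lam unfolding term_eq sums_unique[OF shifted_geometric_deriv_sums[OF assms(1)], symmetric] by simp
    then show ?thesis by (simp add: lam Gamma_numeral)
  qed
  show "cmod (f (complex_of_real x) - gegenbauer_partial lam f N x)
       \<le> M * L * Gamma lam / (pi * Gamma (2 * lam)) *
         (\<Sum>k. Gamma (real (k + N) + 2 * lam) / (Gamma (real (k + N) + lam) * \<rho> ^ (k + N + 1))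
              * hyp2F1 (real (k + N) + 1) (1 - lam) (real (k + N) + lam + 1) (- 1 / \<rho>\<^sup>2))" if lam: "lam > 1"
    unfolding M_def L_def
  proof (rule gegenbauer_remainder_bound[OF assms(1) _ assms(2,3), of _ "\<i> * complex_of_real (inverse \<rho>)"])
    show "(\<i> * complex_of_real (inverse \<rho>))\<^sup>2 = complex_of_real (- 1 / \<rho>\<^sup>2)"
      by (simp add: power_mult_distrib power_inverse divide_inverse)
    show "norm (\<Sum>k. complex_of_real (gauss_coeff lam n k) * (v\<^sup>2) ^ k) \<le> hyp2F1 (real n + 1) (1 - lam) (real n + lam + 1) (- 1 / \<rho>\<^sup>2)"
      if "norm v = inverse \<rho>" for n v
      using norm_gauss_sum_le_of_ge_1[of lam v n] lam that nr by (simp add: power_inverse divide_inverse)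
  qed (use lam assms(1) in \<open>auto simp: norm_mult norm_inverse\<close>)
qed

end
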